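(* Fix $\beta>0$. There is a Dirichlet series $f\in\mathscr{H}^2$ that extends to an entire function (of finite order in every half-plane $\mathbb{C}_\kappa$, $\kappa\in\mathbb{R}$), with \[\sigma_{\mathrm{c}}(f)=\sigma_{\mathrm{a}}(f)=\frac{\beta}{1+2\beta}\] and such that $\mu_f(\sigma)=\beta-(1+2\beta)\sigma$ for every real $\sigma\leq\frac{\beta}{1+2\beta}$.
   Context: Write $s=\sigma+it$ and, for real $\kappa$, $\mathbb{C}_\kappa=\{s=\sigma+it : \sigma>\kappa\}$. $\mathscr{H}^2$ is the Hilbert space of Dirichlet series $f(s)=\sum_{n\geq1}a_n n^{-s}$ with complex coefficients and $\|f\|_{\mathscr{H}^2}^2=\sum_{n\geq1}|a_n|^2<\infty$; such a series converges absolutely and is analytic in $\mathbb{C}_{1/2}$. The entire extension of $f$ is again denoted $f$. $\sigma_{\mathrm{c}}(f)$ and $\sigma_{\mathrm{a}}(f)$ denote the abscissa of convergence and the abscissa of absolute convergence of the Dirichlet series $f$. An analytic function $f$ on $\mathbb{C}_\kappa$ is of finite order in $\mathbb{C}_\kappa$ if for every $\varepsilon>0$ there are constants $A,B$ such that $|f(\sigma+it)|\leq B(1+|t|)^A$ for all $\sigma\geq\kappa+\varepsilon$ and all real $t$. For such $f$ the Lindelöf order function is \[\mu_f(\sigma)=\limsup_{|t|\to\infty}\frac{\log|f(\sigma+it)|}{\log|t|},\qquad \sigma>\kappa.\] Statements about $\mu_f$ on $(\kappa,\infty)$ presuppose that $f$ is of finite order in $\mathbb{C}_\kappa$. *)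

theory Defs
  imports "HOL-Complex_Analysis.Complex_Analysis"
begin

(* A Dirichlet series is represented by its coefficients a 1, a 2, ...; the value a 0 is never used. *)

definition dirichlet_term :: "(nat \<Rightarrow> complex) \<Rightarrow> complex \<Rightarrow> nat \<Rightarrow> complex" where
  "dirichlet_term a s k = a (Suc k) * of_nat (Suc k) powr (- s)"

definition hardy_H2 :: "(nat \<Rightarrow> complex) set" where
  "hardy_H2 = {a. summable (\<lambda>k. (cmod (a (Suc k)))\<^sup>2)}"

definition conv_abscissa :: "(nat \<Rightarrow> complex) \<Rightarrow> ereal" where
  "conv_abscissa a = Inf {ereal (Re s) | s. summable (dirichlet_term a s)}"

definition abs_conv_abscissa :: "(nat \<Rightarrow> complex) \<Rightarrow> ereal" where
  "abs_conv_abscissa a = Inf {ereal (Re s) | s. summable (\<lambda>k. cmod (dirichlet_term a s k))}"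

definition half_plane :: "real \<Rightarrow> complex set" where
  "half_plane \<kappa> = {s. Re s > \<kappa>}"

definition finite_order_on_half_plane :: "(complex \<Rightarrow> complex) \<Rightarrow> real \<Rightarrow> bool" where
  "finite_order_on_half_plane f \<kappa> \<longleftrightarrow>
     f holomorphic_on half_plane \<kappa> \<and>
     (\<forall>\<epsilon>>0. \<exists>A B :: real. \<forall>\<sigma> t :: real. \<sigma> \<ge> \<kappa> + \<epsilon> \<longrightarrow>
        cmod (f (Complex \<sigma> t)) \<le> B * (1 + \<bar>t\<bar>) powr A)"

(* The library has ln 0 = 0; here the convention log 0 = -\<infinity> is needed, so that zeros of f
   do not affect the limsup. *)
definition log_norm :: "complex \<Rightarrow> ereal" where
  "log_norm z = (if z = 0 then - \<infinity> else ereal (ln (cmod z)))"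

(* For real t, the filter at_infinity describes \<bar>t\<bar> \<rightarrow> \<infinity>. *)
definition lindelof_order :: "(complex \<Rightarrow> complex) \<Rightarrow> real \<Rightarrow> ereal" where
  "lindelof_order f \<sigma> =
     Limsup at_infinity (\<lambda>t :: real. log_norm (f (Complex \<sigma> t)) / ereal (ln \<bar>t\<bar>))"

(* f is an entire extension of the sum of the series. Membership in H2 gives convergence
   only for Re s > 1/2. *)
definition entire_extension :: "(nat \<Rightarrow> complex) \<Rightarrow> (complex \<Rightarrow> complex) \<Rightarrow> bool" where
  "entire_extension a f \<longleftrightarrow>
     f holomorphic_on UNIV \<and> (\<forall>s \<in> half_plane (1/2). dirichlet_term a s sums f s)"

end

theory Submission
  imports Defs "HOL-Real_Asymp.Real_Asymp"
begin

text \<open>The series is a sum of sparse blocks. Put \<open>\<theta> = \<beta> / (1 + 2 * \<beta>)\<close> and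
\<open>v = 1 / (1 + 2 * \<beta>) = 1 - 2 * \<theta>\<close>. The \<open>i\<close>-th block is supported just above a huge integer \<open>N\<close>
and is an \<open>i\<close>-th finite difference, with step \<open>4 * L\<close>, of the averaged powers
\<open>\<Sum>l<L. (x + l) powr - s\<close>. Its length \<open>L\<close> is about \<open>N powr (2 * \<theta>)\<close> and its coefficients are about
\<open>N powr - \<theta>\<close>, up to factors smaller than any power of \<open>N\<close>. This choice balances the requirements:
the square sum of the coefficients of a block is bounded by a summable sequence, while their absolute sum is about
\<open>N powr \<theta>\<close>, so that \<open>\<theta>\<close> is the abscissa of absolute convergence.

As a function of \<open>t = Im s\<close> the block changes its behaviour at the height \<open>N / L\<close>, which is about
\<open>N powr v\<close>. Far below this height the differences cancel: an \<open>i\<close>-th difference is at most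
\<open>(4 * L) ^ i\<close> times an \<open>i\<close>-th derivative, which gives the factor
\<open>(\<bar>s\<bar> * L / N) ^ i\<close> up to factors smaller than any power of \<open>N\<close>
(lemma \<open>block_le_cancellation\<close>). Because the order \<open>i\<close> tends to infinity, this beats every fixed power of \<open>N\<close>, so the blocks sum to an entire function. At the height
\<open>pi * N / (4 * L)\<close> the step of the difference turns the phase by \<open>pi\<close>, which compensates the
alternating signs; all terms then point in nearly the same direction, and for large \<open>i\<close> the block has modulus at least
\<open>N powr (\<theta> - \<sigma>)\<close> (lemma \<open>block_ge\<close>). Since the height is about \<open>N powr v\<close>, the exponent in terms
of \<open>t\<close> is \<open>(\<theta> - \<sigma>) / v = \<beta> - (1 + 2 * \<beta>) * \<sigma>\<close>.

For the upper bound of the order function each block is estimated trivially when \<open>N powr v\<close> is at most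
of the size of \<open>\<bar>t\<bar>\<close>, and by cancellation otherwise (lemma \<open>block_uniform_bound\<close>). For the lower bound
(lemma \<open>F_large\<close>) the blocks after the resonating one are negligible by cancellation, since the \<open>N\<close> grow
doubly exponentially. The earlier ones are negligible because of a slowly growing factor \<open>boost\<close> in the length
of the blocks; it is what makes the argument work on the line \<open>\<sigma> = \<theta>\<close> itself, where all
powers \<open>N powr (\<theta> - \<sigma>)\<close> equal \<open>1\<close>. At a fixed height, the coherent run of \<open>L\<close> terms at the start of
each block prevents convergence of the series to the left of \<open>\<theta>\<close>.\<close>

section \<open>Finite differences of complex powers\<close>

text \<open>Pascal's rule: an alternating binomial sum of order \<open>m + 1\<close> is one of order \<open>m\<close> over the first differences.
This is the induction step for bounds on iterated differences.\<close>
lemma alternating_binomial_sum_Suc: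
  fixes u :: "nat \<Rightarrow> complex"
  shows "(\<Sum>k\<le>Suc m. (-1)^k * of_nat (Suc m choose k) * u k)
       = (\<Sum>k\<le>m. (-1)^k * of_nat (m choose k) * (u k - u (Suc k)))"
proof -
  have "(\<Sum>k\<le>Suc m. (-1)^k * of_nat (Suc m choose k) * u k)
      = u 0 + (\<Sum>k\<le>m. (-1)^(Suc k) * of_nat (Suc m choose Suc k) * u (Suc k))"
    by (subst sum.atMost_Suc_shift) simp
  also have "\<dots> = (u 0 + (\<Sum>k\<le>m. (-1)^(Suc k) * of_nat (m choose Suc k) * u (Suc k)))
                  - (\<Sum>k\<le>m. (-1)^k * of_nat (m choose k) * u (Suc k))"
    by (simp add: algebra_simps sum.distrib sum_subtractf sum_negf)
  also have "u 0 + (\<Sum>k\<le>m. (-1)^(Suc k) * of_nat (m choose Suc k) * u (Suc k))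
      = (\<Sum>k\<le>Suc m. (-1)^k * of_nat (m choose k) * u k)"
    by (subst sum.atMost_Suc_shift) simp
  also have "\<dots> = (\<Sum>k\<le>m. (-1)^k * of_nat (m choose k) * u k)"
    by simp
  finally show ?thesis
    by (simp add: algebra_simps sum_subtractf)
qed

text \<open>Each of the \<open>m\<close> differences costs a factor \<open>h\<close> and one derivative, by the mean value inequality on the ray from
\<open>x\<close>. The derivatives are given as a sequence \<open>G\<close>, so that passing to \<open>\<lambda>z. G j z - G j (z + h)\<close>
preserves the hypotheses.\<close>
lemma binomial_difference_bound:
  fixes G :: "nat \<Rightarrow> complex \<Rightarrow> complex" and x h B :: real
  assumes "h \<ge> 0"
    and "\<And>j y. j < m \<Longrightarrow> y \<ge> x \<Longrightarrow>
           (G j has_field_derivative G (Suc j) (of_real y)) (at (of_real y))"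
    and "\<And>y. y \<ge> x \<Longrightarrow> cmod (G m (of_real y)) \<le> B"
  shows "cmod (\<Sum>k\<le>m. (-1)^k * of_nat (m choose k) * G 0 (of_real (x + real k * h))) \<le> h^m * B"
  using assms(2,3)
proof (induction m arbitrary: G B)
  case 0
  then show ?case using 0(2)[of x] by simp
next
  case (Suc m)
  define H where "H j z = G j z - G j (z + of_real h)" for j z
  have "cmod (\<Sum>k\<le>m. (-1)^k * of_nat (m choose k) * H 0 (of_real (x + real k * h))) \<le> h^m * (h * B)"
  proof (rule Suc.IH)
    fix j y assume jy: "j < m" "x \<le> y"
    have 1: "(G j has_field_derivative G (Suc j) (of_real y)) (at (of_real y))"
      using Suc.prems(1) jy by simp
    have "(G j has_field_derivative G (Suc j) (of_real (y + h))) (at (of_real (y + h)))"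
      using jy assms(1) by (intro Suc.prems(1)) auto
    then have "((\<lambda>z. G j (z + of_real h)) has_field_derivative G (Suc j) (of_real y + of_real h)) (at (of_real y))"
      by (simp add: DERIV_shift)
    then show "(H j has_field_derivative H (Suc j) (of_real y)) (at (of_real y))"
      unfolding H_def by (intro DERIV_diff 1)
  next
    fix y assume y: "x \<le> y"
    have conv: "convex (complex_of_real ` {x..})"
      by (intro convex_linear_image bounded_linear.linear bounded_linear_of_real convex_real_interval)
    have "cmod (G m (of_real y) - G m (of_real (y + h))) \<le> B * cmod (of_real y - of_real (y + h))"
    proof (rule field_differentiable_bound[OF conv, where f' = "G (Suc m)"])
      fix z assume "z \<in> complex_of_real ` {x..}"
      then obtain w where w: "z = of_real w" "w \<ge> x" by auto
      show "(G m has_field_derivative G (Suc m) z) (at z within complex_of_real ` {x..})"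
        unfolding w(1) by (rule has_field_derivative_at_within, rule Suc.prems(1)) (use w(2) in simp_all)
      show "cmod (G (Suc m) z) \<le> B"
        unfolding w(1) by (rule Suc.prems(2)[OF w(2)])
    qed (use y assms(1) in \<open>auto simp del: of_real_add\<close>)
    also have "cmod (of_real y - of_real (y + h)) = h"
      using assms(1) by simp
    finally show "cmod (H m (of_real y)) \<le> h * B"
      by (simp add: H_def mult.commute)
  qed
  also have "(\<Sum>k\<le>m. (-1)^k * of_nat (m choose k) * H 0 (of_real (x + real k * h)))
     = (\<Sum>k\<le>Suc m. (-1)^k * of_nat (Suc m choose k) * G 0 (of_real (x + real k * h)))"
    unfolding alternating_binomial_sum_Suc by (simp add: H_def algebra_simps)
  finally show ?case by (simp add: mult_ac)
qed

text \<open>The \<open>m\<close>-th derivative of \<open>z powr - s\<close> is \<open>z powr (- s - m)\<close> times a product of \<open>m\<close> factors of modulus at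
most \<open>\<bar>s\<bar> + m\<close>. The condition on \<open>Re s + m\<close> makes the power non-increasing on the ray, so its value
at the left end counts.\<close>
lemma powr_difference_bound:
  fixes s :: complex and x h :: real
  assumes "x > 0" "h \<ge> 0" "Re s + real m \<ge> 0"
  shows "cmod (\<Sum>k\<le>m. (-1)^k * of_nat (m choose k) * of_real (x + real k * h) powr (- s))
         \<le> h^m * ((cmod s + real m)^m * x powr (- Re s - real m))"
proof -
  define G where "G = (\<lambda>j z. (\<Prod>r<j. - s - of_nat r) * z powr (- s - of_nat j))"
  have "cmod (\<Sum>k\<le>m. (-1)^k * of_nat (m choose k) * G 0 (of_real (x + real k * h)))
         \<le> h^m * ((cmod s + real m)^m * x powr (- Re s - real m))"
  proof (rule binomial_difference_bound[OF assms(2)])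
    fix j y assume y: "x \<le> y"
    have "complex_of_real y \<notin> \<real>\<^sub>\<le>\<^sub>0" using y assms(1) by simp
    from DERIV_cmult[OF has_field_derivative_powr[OF this], of "\<Prod>r<j. - s - of_nat r" "- s - of_nat j"]
    show "(G j has_field_derivative G (Suc j) (of_real y)) (at (of_real y))"
      by (simp add: G_def mult_ac diff_diff_eq add.commute)
  next
    fix y assume y: "x \<le> y"
    have "cmod (\<Prod>r<m. - s - of_nat r) \<le> (\<Prod>r<m. cmod s + real m)"
      unfolding prod_norm[symmetric]
    proof (intro prod_mono conjI)
      fix r assume "r \<in> {..<m}"
      then show "cmod (- s - of_nat r) \<le> cmod s + real m"
        using norm_triangle_ineq4[of "- s" "of_nat r"] by simp
    qed auto
    moreover have "y powr (- Re s - real m) \<le> x powr (- Re s - real m)"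
      using y assms by (intro powr_mono2') auto
    ultimately show "cmod (G m (of_real y)) \<le> (cmod s + real m)^m * x powr (- Re s - real m)"
      using y assms(1) unfolding G_def norm_mult
      by (intro mult_mono) (auto simp: norm_powr_real_powr)
  qed
  then show ?thesis by (simp add: G_def)
qed

section \<open>Phases of complex powers\<close>

lemma powr_dyadic_bounds:
  fixes x y \<sigma> :: real
  assumes "0 < x" "x \<le> y" "y \<le> 2 * x"
  shows "2 powr (- \<bar>\<sigma>\<bar>) * x powr \<sigma> \<le> y powr \<sigma>" "y powr \<sigma> \<le> 2 powr \<bar>\<sigma>\<bar> * x powr \<sigma>"
proof -
  have r: "1 \<le> y / x" "y / x \<le> 2" "0 < y / x" using assms by (auto simp: field_simps)
  have "\<bar>\<sigma> * ln (y / x)\<bar> = \<bar>\<sigma>\<bar> * ln (y / x)" using r by (simp add: abs_mult)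
  also have "\<dots> \<le> \<bar>\<sigma>\<bar> * ln 2" using r by (intro mult_left_mono) auto
  finally have b: "\<bar>\<sigma> * ln (y / x)\<bar> \<le> \<bar>\<sigma>\<bar> * ln 2" .
  have e: "y powr \<sigma> = exp (\<sigma> * ln (y / x)) * x powr \<sigma>"
    using assms by (simp add: powr_def ln_div flip: exp_add) (simp add: algebra_simps)
  show "2 powr (- \<bar>\<sigma>\<bar>) * x powr \<sigma> \<le> y powr \<sigma>" "y powr \<sigma> \<le> 2 powr \<bar>\<sigma>\<bar> * x powr \<sigma>"
    unfolding e using b assms by (auto intro!: mult_right_mono simp: powr_def abs_le_iff)
qed

lemma cos_ge_half:
  assumes "\<bar>y\<bar> \<le> pi / 3" shows "cos y \<ge> 1/2"
proof -
  have "cos (pi/3) \<le> cos \<bar>y\<bar>" using assms by (intro cos_monotone_0_pi_le) auto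
  then show ?thesis by (simp add: cos_60)
qed

text \<open>Coherence criterion: multiplication by \<open>x powr (\<i> * t)\<close> removes the phase common to the whole block that starts at
\<open>x\<close>. If the remaining phase is within \<open>pi / 3\<close> of \<open>k * pi\<close>, the sign \<open>(-1)^k\<close> turns the term into the right half-plane,
and at least half of its modulus is left as real part. Terms satisfying this cannot cancel.\<close>
lemma Re_rotated_powr_ge:
  fixes x y \<sigma> t :: real
  assumes "0 < x" "x \<le> y" "y \<le> 2 * x" "\<bar>t * ln (y / x) - real k * pi\<bar> \<le> pi / 3"
  shows "Re ((-1)^k * of_real x powr (\<i> * of_real t) * of_real y powr (- Complex \<sigma> t))
         \<ge> 2 powr (- \<bar>\<sigma>\<bar>) * x powr (- \<sigma>) / 2"
proof -
  have m1: "(-1)^k = cis (real k * pi)" using Complex.DeMoivre[of pi k] unfolding cis_pi by simp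
  have "(-1)^k * of_real x powr (\<i> * of_real t) * of_real y powr (- Complex \<sigma> t)
      = of_real (y powr (- \<sigma>)) * cis (real k * pi - t * ln (y / x))"
  proof -
    have "Ln (complex_of_real x) = of_real (ln x)" "Ln (complex_of_real y) = of_real (ln y)"
      using assms by (simp_all add: Ln_of_real)
    then have "of_real x powr (\<i> * of_real t) * of_real y powr (- Complex \<sigma> t)
      = exp (\<i> * of_real t * of_real (ln x) + - Complex \<sigma> t * of_real (ln y))"
      using assms by (simp add: powr_def) (simp flip: exp_add)
    also have "\<i> * of_real t * of_real (ln x) + - Complex \<sigma> t * of_real (ln y)
       = of_real (- \<sigma> * ln y) + \<i> * of_real (- (t * ln (y / x)))"
      using assms by (simp add: complex_eq_iff ln_div algebra_simps)
    also have "exp \<dots> = of_real (y powr (- \<sigma>)) * cis (- (t * ln (y / x)))"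
      using assms unfolding exp_add cis_conv_exp exp_of_real by (simp add: powr_def)
    finally show ?thesis
      unfolding m1 by (simp add: mult.assoc) (simp add: mult_ac cis_mult)
  qed
  then have "Re ((-1)^k * of_real x powr (\<i> * of_real t) * of_real y powr (- Complex \<sigma> t))
     = y powr (- \<sigma>) * cos (t * ln (y / x) - real k * pi)"
    by (simp add: cos_diff)
  also have "\<dots> \<ge> (2 powr (- \<bar>\<sigma>\<bar>) * x powr (- \<sigma>)) * (1/2)"
    using powr_dyadic_bounds(1)[OF assms(1-3), of "- \<sigma>"] cos_ge_half[OF assms(4)]
    by (intro mult_mono) auto
  finally show ?thesis by simp
qed

lemma norm_of_nat_powr: "cmod (of_nat n powr s) = real n powr Re s"
  by (subst norm_powr_real_powr) auto

section \<open>A single block\<close>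

text \<open>Quotient and remainder of \<open>n - N\<close> by \<open>4 * L\<close> recover the position \<open>N + k * (4 * L) + l\<close>. The runs of \<open>L\<close> terms are
separated by gaps of length \<open>3 * L\<close>; then the phases inside a run spread over at most \<open>pi / 4\<close> when the step
\<open>4 * L\<close> corresponds to \<open>pi\<close>. The binomial coefficient vanishes for \<open>k > m\<close>, which ends the block.\<close>
definition block_coeff :: "nat \<Rightarrow> nat \<Rightarrow> nat \<Rightarrow> nat \<Rightarrow> real" where
  "block_coeff N L m n =
     (if N \<le> n \<and> (n - N) mod (4 * L) < L
      then (-1) ^ ((n - N) div (4 * L)) * real (m choose ((n - N) div (4 * L))) else 0)"

definition block_poly :: "nat \<Rightarrow> nat \<Rightarrow> nat \<Rightarrow> complex \<Rightarrow> complex" where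
  "block_poly N L m s =
     (\<Sum>k\<le>m. \<Sum>l<L. (-1) ^ k * of_nat (m choose k) * of_nat (N + k * (4 * L) + l) powr (- s))"

lemma block_coeff_eq_0:
  assumes "n < N \<or> N + Suc m * (4 * L) \<le> n"
  shows "block_coeff N L m n = 0"
proof (cases "N \<le> n \<and> L > 0")
  case True
  then have "Suc m * (4 * L) \<le> n - N" using assms by auto
  then have "Suc m \<le> (n - N) div (4 * L)" using True by (simp add: less_eq_div_iff_mult_less_eq)
  then show ?thesis using binomial_eq_0[of m "(n - N) div (4 * L)"] by (simp add: block_coeff_def)
qed (auto simp: block_coeff_def)

text \<open>With a general \<open>h\<close> this serves for the values of the Dirichlet polynomial, for its absolute coefficient sums and for the
square sums alike.\<close>
lemma sum_block_coeff:
  fixes h :: "nat \<Rightarrow> real \<Rightarrow> 'a :: comm_monoid_add"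
  assumes h0: "\<And>n. h n 0 = 0" and M: "N + Suc m * (4 * L) \<le> M"
  shows "(\<Sum>n\<in>{N..<M}. h n (block_coeff N L m n))
       = (\<Sum>k\<le>m. \<Sum>l<L. h (N + k * (4 * L) + l) ((-1) ^ k * real (m choose k)))"
proof (cases "L = 0")
  case True
  then show ?thesis by (simp add: block_coeff_def h0)
next
  case False
  define D where "D = 4 * L"
  have D: "D > 0" "L \<le> D" using False by (auto simp: D_def)
  let ?g = "\<lambda>n. h n (block_coeff N L m n)"
  have "(\<Sum>n\<in>{N..<M}. ?g n) = (\<Sum>n\<in>{N..<N + Suc m * D}. ?g n)"
  proof (rule sum.mono_neutral_right)
    show "\<forall>n\<in>{N..<M} - {N..<N + Suc m * D}. ?g n = 0"
      using block_coeff_eq_0[of _ N m L] h0 by (auto simp: D_def)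
  qed (use M in \<open>auto simp: D_def\<close>)
  also have "\<dots> = (\<Sum>n<Suc m * D. ?g (N + n))"
    by (subst sum.atLeastLessThan_shift_0) (simp add: atLeast0LessThan)
  also have "\<dots> = (\<Sum>k<Suc m. \<Sum>n\<in>{k * D..<k * D + D}. ?g (N + n))"
    by (rule sum.nat_group[symmetric])
  also have "\<dots> = (\<Sum>k<Suc m. \<Sum>l<D. ?g (N + (k * D + l)))"
    by (subst sum.atLeastLessThan_shift_0) (simp add: atLeast0LessThan)
  also have "\<dots> = (\<Sum>k\<le>m. \<Sum>l<L. h (N + k * D + l) ((-1) ^ k * real (m choose k)))"
  proof (rule sum.cong)
    fix k
    have "(\<Sum>l<D. ?g (N + (k * D + l))) = (\<Sum>l<L. ?g (N + (k * D + l)))"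
      using D by (intro sum.mono_neutral_right) (auto simp: block_coeff_def h0 simp flip: D_def)
    also have "\<dots> = (\<Sum>l<L. h (N + k * D + l) ((-1) ^ k * real (m choose k)))"
      using D by (intro sum.cong) (auto simp: block_coeff_def add.assoc simp flip: D_def)
    finally show "(\<Sum>l<D. ?g (N + (k * D + l)))
       = (\<Sum>l<L. h (N + k * D + l) ((-1) ^ k * real (m choose k)))" .
  qed auto
  finally show ?thesis by (simp add: D_def)
qed

text \<open>The block lies in \<open>{N..2 * N}\<close>, where powers are comparable to those of \<open>N\<close>. The bound depends only on a lower bound
\<open>\<kappa>\<close> for the real part, which makes the later estimates uniform in half-planes.\<close>
lemma sum_powr_block_le:
  fixes \<kappa> \<sigma> :: real
  assumes "N > 0" "Suc m * (4 * L) \<le> N" "\<kappa> \<le> \<sigma>"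
  shows "(\<Sum>k\<le>m. \<Sum>l<L. real (m choose k) * real (N + k * (4 * L) + l) powr (- \<sigma>))
         \<le> 2 ^ m * real L * (2 powr \<bar>\<kappa>\<bar> * real N powr (- \<kappa>))"
proof -
  have t: "real (N + k * (4 * L) + l) powr (- \<sigma>) \<le> 2 powr \<bar>\<kappa>\<bar> * real N powr (- \<kappa>)"
    if "k \<le> m" "l < L" for k l
  proof -
    let ?n = "N + k * (4 * L) + l"
    have "k * (4 * L) \<le> m * (4 * L)" using that by (intro mult_right_mono) auto
    then have n: "N \<le> ?n" "?n \<le> 2 * N" using assms(2) that unfolding mult_Suc by linarith+
    then have "1 \<le> real ?n" "real N \<le> real ?n" "real ?n \<le> 2 * real N" using assms(1) by linarith+
    then show ?thesis
      using powr_dyadic_bounds(2)[of "real N" "real ?n" "- \<kappa>"] assms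
        powr_mono[of "- \<sigma>" "- \<kappa>" "real ?n"] by auto
  qed
  have "(\<Sum>k\<le>m. \<Sum>l<L. real (m choose k) * real (N + k * (4 * L) + l) powr (- \<sigma>))
     \<le> (\<Sum>k\<le>m. \<Sum>l<L. real (m choose k) * (2 powr \<bar>\<kappa>\<bar> * real N powr (- \<kappa>)))"
    by (intro sum_mono mult_left_mono t) auto
  also have "\<dots> = (\<Sum>k\<le>m. real (m choose k)) * (real L * (2 powr \<bar>\<kappa>\<bar> * real N powr (- \<kappa>)))"
    unfolding sum_distrib_right by (simp add: mult_ac)
  also have "(\<Sum>k\<le>m. real (m choose k)) = 2 ^ m"
    by (simp add: choose_row_sum flip: of_nat_sum)
  finally show ?thesis by (simp add: mult_ac)
qed

text \<open>For each fixed \<open>l\<close> the sum over \<open>k\<close> is an \<open>m\<close>-th difference with step \<open>4 * L\<close>.\<close>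
lemma norm_block_poly_cancellation:
  assumes "N > 0" "\<kappa> \<le> Re s" "0 \<le> \<kappa> + real m"
  shows "cmod (block_poly N L m s)
     \<le> real L * ((4 * real L) ^ m * ((cmod s + real m) ^ m * real N powr (- \<kappa> - real m)))"
proof -
  have "cmod (block_poly N L m s)
      = cmod (\<Sum>l<L. \<Sum>k\<le>m. (-1) ^ k * of_nat (m choose k) * of_real (real (N + l) + real k * (4 * real L)) powr (- s))"
    unfolding block_poly_def by (subst sum.swap) (simp add: algebra_simps)
  also have "\<dots> \<le> (\<Sum>l<L. (4 * real L) ^ m * ((cmod s + real m) ^ m * real N powr (- \<kappa> - real m)))"
  proof (rule sum_norm_le)
    fix l
    have "cmod (\<Sum>k\<le>m. (-1) ^ k * of_nat (m choose k) * of_real (real (N + l) + real k * (4 * real L)) powr (- s))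
      \<le> (4 * real L) ^ m * ((cmod s + real m) ^ m * real (N + l) powr (- Re s - real m))"
      by (rule powr_difference_bound) (use assms in auto)
    also have "real (N + l) powr (- Re s - real m) \<le> real N powr (- Re s - real m)"
      using assms by (intro powr_mono2') auto
    also have "\<dots> \<le> real N powr (- \<kappa> - real m)"
      using assms by (intro powr_mono) auto
    finally show "cmod (\<Sum>k\<le>m. (-1) ^ k * of_nat (m choose k) * of_real (real (N + l) + real k * (4 * real L)) powr (- s))
      \<le> (4 * real L) ^ m * ((cmod s + real m) ^ m * real N powr (- \<kappa> - real m))"
      by (simp add: mult_left_mono)
  qed
  also have "\<dots> = real L * ((4 * real L) ^ m * ((cmod s + real m) ^ m * real N powr (- \<kappa> - real m)))"
    by simp
  finally show ?thesis .
qed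

text \<open>As long as \<open>\<bar>t\<bar> * L \<le> N\<close>, the phase varies by at most \<open>1 \<le> pi / 3\<close> along a run of \<open>L\<close> terms.\<close>
lemma norm_block_front_ge:
  fixes \<sigma> t :: real
  assumes "N > 0" "L \<le> N" "\<bar>t\<bar> * real L \<le> real N"
  shows "cmod (\<Sum>l<L. of_nat (N + l) powr (- Complex \<sigma> t)) \<ge> real L * (2 powr (- \<bar>\<sigma>\<bar>) * real N powr (- \<sigma>) / 2)"
proof -
  let ?u = "of_real (real N) powr (\<i> * of_real t)"
  have u: "cmod ?u = 1"
    by (subst norm_powr_real_powr) (use assms(1) in auto)
  have "real L * (2 powr (- \<bar>\<sigma>\<bar>) * real N powr (- \<sigma>) / 2)
      = (\<Sum>l<L. 2 powr (- \<bar>\<sigma>\<bar>) * real N powr (- \<sigma>) / 2)" by simp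
  also have "\<dots> \<le> (\<Sum>l<L. Re ((-1)^0 * ?u * of_real (real (N + l)) powr (- Complex \<sigma> t)))"
  proof (intro sum_mono Re_rotated_powr_ge)
    fix l assume l: "l \<in> {..<L}"
    have e: "real (N + l) / real N = 1 + real l / real N" using assms(1) by (simp add: field_simps)
    have "\<bar>t * ln (real (N + l) / real N)\<bar> = \<bar>t\<bar> * ln (1 + real l / real N)"
      unfolding e abs_mult using assms(1) by simp
    also have "\<dots> \<le> \<bar>t\<bar> * (real l / real N)"
      by (intro mult_left_mono ln_add_one_self_le_self) auto
    also have "\<dots> \<le> \<bar>t\<bar> * (real L / real N)"
      using l by (intro mult_left_mono divide_right_mono) auto
    also have "\<dots> \<le> 1" using assms by (simp add: field_simps)
    also have "1 \<le> pi / 3" using pi_gt3 by simp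
    finally show "\<bar>t * ln (real (N + l) / real N) - real 0 * pi\<bar> \<le> pi / 3" by simp
  qed (use assms in auto)
  also have "\<dots> = Re (?u * (\<Sum>l<L. of_nat (N + l) powr (- Complex \<sigma> t)))"
    by (simp add: sum_distrib_left)
  also have "\<dots> \<le> cmod (?u * (\<Sum>l<L. of_nat (N + l) powr (- Complex \<sigma> t)))"
    by (rule complex_Re_le_cmod)
  also have "\<dots> = cmod (\<Sum>l<L. of_nat (N + l) powr (- Complex \<sigma> t))"
    by (simp only: norm_mult u mult_1_left)
  finally show ?thesis .
qed

text \<open>Resonance. At this \<open>t\<close> the linear part of the phase of the term \<open>(k, l)\<close> is \<open>k * pi\<close> plus at most \<open>pi / 4\<close>. The assumption
that \<open>N\<close> is large compared with \<open>m\<^sup>2 * L\<close> keeps the quadratic error of the logarithm below \<open>pi / 12\<close>, and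
\<open>pi / 4 + pi / 12 = pi / 3\<close>. Every term then has a positive real part, and those with \<open>k = 0\<close> already give the bound.\<close>
lemma norm_block_poly_ge:
  fixes \<sigma> t :: real
  assumes L: "L > 0" and NL: "48 * (Suc m)\<^sup>2 * L \<le> N" and t: "t = pi * real N / (4 * real L)"
  shows "cmod (block_poly N L m (Complex \<sigma> t)) \<ge> real L * (2 powr (- \<bar>\<sigma>\<bar>) * real N powr (- \<sigma>) / 2)"
proof -
  let ?u = "of_real (real N) powr (\<i> * of_real t)"
  let ?c = "2 powr (- \<bar>\<sigma>\<bar>) * real N powr (- \<sigma>) / 2"
  have N: "N > 0" "48 * (real (Suc m))\<^sup>2 * real L \<le> real N"
    using NL L by (auto intro: Nat.gr0I simp flip: of_nat_power of_nat_mult simp del: of_nat_Suc)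
      (metis (mono_tags) of_nat_le_iff of_nat_mult of_nat_numeral)
  have u: "cmod ?u = 1"
    by (subst norm_powr_real_powr) (use N(1) in auto)
  have term_ge: "Re ((-1)^k * ?u * of_real (real (N + k * (4 * L) + l)) powr (- Complex \<sigma> t)) \<ge> ?c"
    if kl: "k \<le> m" "l < L" for k l
  proof (rule Re_rotated_powr_ge)
    define x where "x = real (k * (4 * L) + l)"
    have "k * (4 * L) \<le> m * (4 * L)" using kl by (intro mult_right_mono) auto
    then have "k * (4 * L) + l \<le> Suc m * (4 * L)" using kl unfolding mult_Suc by linarith
    then have "x \<le> real (Suc m * (4 * L))"
      unfolding x_def by (rule of_nat_mono)
    then have x: "0 \<le> x" "x \<le> real (Suc m) * (4 * real L)"
      by (simp_all only: x_def of_nat_0_le_iff of_nat_mult of_nat_numeral)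
    have "real (Suc m) * (4 * real L) \<le> 48 * (real (Suc m))\<^sup>2 * real L"
      by (simp add: power2_eq_square algebra_simps)
    then have xN: "x \<le> real N" using x N by linarith
    have "x\<^sup>2 * 3 \<le> (real (Suc m) * (4 * real L))\<^sup>2 * 3" using x by (intro mult_right_mono power_mono) auto
    also have "\<dots> = (48 * (real (Suc m))\<^sup>2 * real L) * real L" by (simp add: power2_eq_square)
    also have "\<dots> \<le> real N * real L" using N by (intro mult_right_mono) auto
    finally have x2: "x\<^sup>2 * 3 \<le> real N * real L" .
    have e: "real (N + k * (4 * L) + l) / real N = 1 + x / real N"
      using N(1) by (simp add: x_def field_simps)
    have "\<bar>ln (1 + x / real N) - x / real N\<bar> \<le> (x / real N)\<^sup>2"
      using x xN N(1) by (intro abs_ln_one_plus_x_minus_x_bound_nonneg) auto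
    then have "t * \<bar>ln (1 + x / real N) - x / real N\<bar> \<le> t * (x / real N)\<^sup>2"
      by (intro mult_left_mono) (simp_all add: t)
    moreover have "t \<ge> 0" by (simp add: t)
    ultimately have "\<bar>t * ln (1 + x / real N) - t * (x / real N)\<bar> \<le> t * (x / real N)\<^sup>2"
      by (simp only: right_diff_distrib[symmetric] abs_mult abs_of_nonneg)
    also have "\<dots> = pi * (x\<^sup>2 / (real N * real L)) / 4"
      using N(1) L by (simp add: t power2_eq_square field_simps)
    also have "\<dots> \<le> pi * (1 / 3) / 4"
      using x2 N(1) L by (intro divide_right_mono mult_left_mono) (auto simp: field_simps)
    finally have err: "\<bar>t * ln (1 + x / real N) - t * (x / real N)\<bar> \<le> pi / 12" by simp
    have "t * (x / real N) = real k * pi + pi * (real l / real L) / 4"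
      using N(1) L by (simp add: t x_def field_simps)
    moreover have "pi * (real l / real L) / 4 \<le> pi * 1 / 4" "0 \<le> pi * (real l / real L) / 4"
      using kl by (intro divide_right_mono mult_left_mono; simp; fail) simp
    ultimately show "\<bar>t * ln (real (N + k * (4 * L) + l) / real N) - real k * pi\<bar> \<le> pi / 3"
      using err unfolding e by linarith
    show "real (N + k * (4 * L) + l) \<le> 2 * real N" "real N \<le> real (N + k * (4 * L) + l)"
      using xN by (auto simp: x_def)
  qed (use N in auto)
  have c: "?c \<ge> 0" by simp
  have "real L * ?c = (\<Sum>l<L. real (m choose 0) * ?c)" by simp
  also have "\<dots> \<le> (\<Sum>k\<le>m. \<Sum>l<L. real (m choose k) * ?c)"
    by (rule member_le_sum[where f = "\<lambda>k. \<Sum>l<L. real (m choose k) * ?c" and i = 0]) (auto intro!: sum_nonneg)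
  also have "\<dots> \<le> (\<Sum>k\<le>m. \<Sum>l<L. real (m choose k) *
       Re ((-1)^k * ?u * of_real (real (N + k * (4 * L) + l)) powr (- Complex \<sigma> t)))"
    by (intro sum_mono mult_left_mono term_ge) auto
  also have "\<dots> = Re (?u * block_poly N L m (Complex \<sigma> t))"
    unfolding block_poly_def sum_distrib_left Re_sum
    by (intro sum.cong refl) (simp add: mult_ac flip: Re_complex_of_real)
  also have "\<dots> \<le> cmod (?u * block_poly N L m (Complex \<sigma> t))"
    by (rule complex_Re_le_cmod)
  also have "\<dots> = cmod (block_poly N L m (Complex \<sigma> t))"
    by (simp only: norm_mult u mult_1_left)
  finally show ?thesis .
qed

lemma holomorphic_block_poly: "N > 0 \<Longrightarrow> block_poly N L m holomorphic_on A"
  unfolding block_poly_def [abs_def] by (intro holomorphic_intros)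

section \<open>Choice of the parameters\<close>

locale lindelof_example =
  fixes \<beta> :: real
  assumes beta_pos: "\<beta> > 0"
begin

text \<open>\<open>N\<close> grows doubly exponentially, with \<open>N (Suc i) = N i ^ 4\<close>; the constant \<open>q\<close> is large enough for the
\<open>i\<close>-th block to fit into \<open>{N i..2 * N i}\<close> from \<open>i = 0\<close> on. The sequence \<open>boost\<close> grows faster than every
geometric sequence, but every function of it that occurs is smaller than any power of \<open>N\<close>. It lengthens the runs by
\<open>boost\<^sup>2\<close> and shrinks the coefficients only by \<open>boost\<close>, so it leaves square sums unchanged and multiplies
absolute sums by \<open>boost\<close>. The factor \<open>4 ^ i\<close> in \<open>amp\<close> pays for the binomial coefficients.\<close>
definition v :: real where "v = 1 / (1 + 2 * \<beta>)"
definition \<theta> :: real where "\<theta> = \<beta> / (1 + 2 * \<beta>)"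
definition q :: nat where "q = nat \<lceil>16 * (1 + 2 * \<beta>)\<rceil>"
definition N :: "nat \<Rightarrow> nat" where "N i = 2 ^ (q * 4 ^ i)"
definition boost :: "nat \<Rightarrow> real" where "boost i = 8 ^ (i\<^sup>2)"
definition L :: "nat \<Rightarrow> nat" where "L i = nat \<lceil>real (N i) powr (2 * \<theta>) * (boost i)\<^sup>2\<rceil>"
definition amp :: "nat \<Rightarrow> real" where "amp i = real (N i) powr (- \<theta>) / (2 * 4 ^ i * boost i)"
definition block_index :: "nat \<Rightarrow> nat" where "block_index n = (LEAST i. n < N (Suc i))"
definition coeff :: "nat \<Rightarrow> complex" where
  "coeff n = of_real (amp (block_index n) * block_coeff (N (block_index n)) (L (block_index n)) (block_index n) n)"
definition blk :: "nat \<Rightarrow> complex \<Rightarrow> complex" where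
  "blk i s = of_real (amp i) * block_poly (N i) (L i) i s"
definition F :: "complex \<Rightarrow> complex" where "F s = (\<Sum>i. blk i s)"

lemma v_pos: "v > 0" and v_le_1: "v \<le> 1" and theta_pos: "\<theta> > 0" and two_theta: "2 * \<theta> = 1 - v"
  using beta_pos by (auto simp: v_def \<theta>_def field_simps)

lemma theta_less_half: "\<theta> < 1/2" using v_pos two_theta by simp

lemma q_v: "real q * v \<ge> 16"
proof -
  have "16 * (1 + 2 * \<beta>) \<le> real q" unfolding q_def using beta_pos by linarith
  then show ?thesis using beta_pos by (simp add: v_def field_simps)
qed

lemma q_pos: "q > 0" using q_v by (cases q) auto

lemma N_pos [simp]: "N i > 0" and N_neq_0 [simp]: "N i \<noteq> 0" by (simp_all add: N_def)

lemma N_ge_2: "N i \<ge> 2"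
proof -
  have "2 ^ 1 \<le> (2::nat) ^ (q * 4 ^ i)" using q_pos by (intro power_increasing) auto
  then show ?thesis by (simp add: N_def)
qed

lemma N_square_le: "i < j \<Longrightarrow> (N i)\<^sup>2 \<le> N j"
proof -
  assume "i < j"
  have "i < j \<Longrightarrow> q * 4 ^ i * 2 \<le> q * 4 ^ j"
    using power_increasing[of "Suc i" j "4::nat"] q_pos by (simp add: Suc_le_eq)
  with \<open>i < j\<close> have "(2::nat) ^ (q * 4 ^ i * 2) \<le> 2 ^ (q * 4 ^ j)" by (intro power_increasing) auto
  then show ?thesis by (simp add: N_def flip: power_mult)
qed

lemma N_mono: "i \<le> j \<Longrightarrow> N i \<le> N j"
  unfolding N_def by (intro power_increasing mult_left_mono) auto

lemma N_strict_mono: "strict_mono N"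
proof (rule strict_monoI_Suc)
  fix i
  have "N i < (N i)\<^sup>2" using N_ge_2[of i] by (simp add: power2_eq_square)
  also have "\<dots> \<le> N (Suc i)" by (rule N_square_le) simp
  finally show "N i < N (Suc i)" .
qed

lemma two_N_le: "2 * N i \<le> N (Suc i)"
proof -
  have "2 * N i \<le> N i * N i" using N_ge_2[of i] by (intro mult_right_mono) auto
  then show ?thesis using N_square_le[of i "Suc i"] unfolding power2_eq_square by linarith
qed

lemma N_powr: "real (N i) powr x = 2 powr (x * real q * 4 ^ i)"
  by (simp add: N_def powr_powr mult_ac flip: powr_realpow)

lemma boost_ge_1: "boost i \<ge> 1" by (simp add: boost_def)
lemma boost_pos [simp]: "boost i > 0" and boost_nonneg [simp]: "boost i \<ge> 0" and boost_neq_0 [simp]: "boost i \<noteq> 0"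
  by (simp_all add: boost_def)

lemma N_powr_ge_1: "x \<ge> 0 \<Longrightarrow> real (N i) powr x \<ge> 1"
  using N_ge_2[of i] by (intro ge_one_powr_ge_zero) auto

text \<open>This says that the height \<open>N powr v\<close> exceeds the boosting factors with room to spare, whence
\<open>48 * (Suc i)\<^sup>2 * L i \<le> N i\<close>, the hypothesis of the resonance lemma.\<close>
lemma boost_square_le: "96 * (real (Suc i))\<^sup>2 * (boost i)\<^sup>2 \<le> real (N i) powr v"
proof -
  have "Suc i \<le> 2 ^ i" by (induction i) auto
  then have "real (Suc i) \<le> real (2 ^ i)" by (rule of_nat_mono)
  then have i: "real (Suc i) \<le> 2 ^ i" by simp
  have boost_eq: "boost i = 2 ^ (3 * i\<^sup>2)"
    unfolding boost_def power_mult by simp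
  have "96 * (real (Suc i))\<^sup>2 * (boost i)\<^sup>2 \<le> 2 ^ 7 * (2 ^ i)\<^sup>2 * (2 ^ (3 * i\<^sup>2))\<^sup>2"
    unfolding boost_eq by (intro mult_mono power_mono i) auto
  also have "2 ^ 7 * (2 ^ i)\<^sup>2 * (2 ^ (3 * i\<^sup>2))\<^sup>2 = (2::real) ^ (7 + 2 * i + 6 * i\<^sup>2)"
    by (simp add: power_add mult_ac flip: power_mult)
  also have "\<dots> \<le> 2 ^ (16 * 4 ^ i)"
  proof (rule power_increasing)
    have "i\<^sup>2 \<le> (2 ^ i)\<^sup>2" by (intro power_mono) auto
    also have "\<dots> = 4 ^ i" by (simp add: power2_eq_square flip: power_mult_distrib)
    finally have "i\<^sup>2 \<le> 4 ^ i" .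
    moreover have "i \<le> i\<^sup>2" by (simp add: power2_eq_square)
    moreover have "(1::nat) \<le> 4 ^ i" by simp
    ultimately show "7 + 2 * i + 6 * i\<^sup>2 \<le> 16 * 4 ^ i" by linarith
  qed simp
  also have "\<dots> = 2 powr (16 * 4 ^ i)" by (simp add: powr_realpow[symmetric])
  also have "\<dots> \<le> 2 powr (v * real q * 4 ^ i)"
    using q_v by (intro powr_mono mult_right_mono) (auto simp: mult.commute)
  finally show ?thesis by (simp add: N_powr)
qed

lemma L_bounds: "real (N i) powr (2 * \<theta>) * (boost i)\<^sup>2 \<le> real (L i)"
  "real (L i) \<le> 2 * (real (N i) powr (2 * \<theta>) * (boost i)\<^sup>2)"
proof -
  have "1 * 1 \<le> real (N i) powr (2 * \<theta>) * (boost i)\<^sup>2"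
    using theta_pos boost_ge_1[of i] by (intro mult_mono N_powr_ge_1) auto
  then show "real (N i) powr (2 * \<theta>) * (boost i)\<^sup>2 \<le> real (L i)"
    "real (L i) \<le> 2 * (real (N i) powr (2 * \<theta>) * (boost i)\<^sup>2)"
    unfolding L_def by linarith+
qed

lemma L_pos [simp]: "L i > 0"
proof -
  have "0 < real (N i) powr (2 * \<theta>) * (boost i)\<^sup>2" by (intro mult_pos_pos zero_less_power) auto
  then show ?thesis using L_bounds(1)[of i] by linarith
qed

lemma L_N: "48 * (Suc i)\<^sup>2 * L i \<le> N i"
proof -
  have "48 * (real (Suc i))\<^sup>2 * real (L i) \<le> 48 * (real (Suc i))\<^sup>2 * (2 * (real (N i) powr (2 * \<theta>) * (boost i)\<^sup>2))"
    by (intro mult_left_mono L_bounds) auto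
  also have "\<dots> = (96 * (real (Suc i))\<^sup>2 * (boost i)\<^sup>2) * real (N i) powr (2 * \<theta>)"
    by simp
  also have "\<dots> \<le> real (N i) powr v * real (N i) powr (2 * \<theta>)"
    by (intro mult_right_mono boost_square_le) auto
  also have "\<dots> = real (N i)"
    by (simp add: two_theta flip: powr_add)
  finally have "real (48 * (Suc i)\<^sup>2 * L i) \<le> real (N i)"
    by (simp only: of_nat_mult of_nat_power of_nat_numeral)
  then show ?thesis by (simp only: of_nat_le_iff)
qed

lemma L_N': "Suc i * (4 * L i) \<le> N i"
proof -
  have "4 * Suc i \<le> 48 * (Suc i)\<^sup>2" by (simp add: power2_eq_square)
  then have "4 * Suc i * L i \<le> 48 * (Suc i)\<^sup>2 * L i" by (rule mult_right_mono) simp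
  then have "Suc i * (4 * L i) \<le> 48 * (Suc i)\<^sup>2 * L i" by (simp only: mult_ac)
  then show ?thesis using L_N[of i] by linarith
qed

lemma four_L_div_N: "4 * real (L i) / real (N i) \<le> 8 * (boost i)\<^sup>2 * real (N i) powr (- v)"
proof -
  have "4 * real (L i) / real (N i) \<le> 4 * (2 * (real (N i) powr (2 * \<theta>) * (boost i)\<^sup>2)) / real (N i)"
    by (intro divide_right_mono mult_left_mono L_bounds) auto
  also have "real (N i) powr (2 * \<theta>) = real (N i) * real (N i) powr (- v)"
    unfolding two_theta by (simp add: powr_diff powr_minus divide_inverse)
  finally show ?thesis by (simp add: mult_ac)
qed

lemma amp_pos [simp]: "amp i > 0" by (simp add: amp_def)

lemma amp_L_bounds:
  "boost i / 4 ^ i / 2 * real (N i) powr \<theta> \<le> amp i * real (L i)"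
  "amp i * real (L i) \<le> boost i / 4 ^ i * real (N i) powr \<theta>"
proof -
  have eq: "amp i * (real (N i) powr (2 * \<theta>) * (boost i)\<^sup>2) = boost i / 4 ^ i / 2 * real (N i) powr \<theta>"
  proof -
    have "real (N i) powr (2 * \<theta>) = real (N i) powr \<theta> * real (N i) powr \<theta>"
      by (simp flip: powr_add)
    then show ?thesis by (simp add: amp_def powr_minus field_simps power2_eq_square)
  qed
  show "boost i / 4 ^ i / 2 * real (N i) powr \<theta> \<le> amp i * real (L i)"
    unfolding eq[symmetric] by (intro mult_left_mono L_bounds) (auto intro: less_imp_le)
  have "amp i * real (L i) \<le> amp i * (2 * (real (N i) powr (2 * \<theta>) * (boost i)\<^sup>2))"
    by (intro mult_left_mono L_bounds) (auto intro: less_imp_le)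
  also have "\<dots> = boost i / 4 ^ i * real (N i) powr \<theta>"
    using eq by simp
  finally show "amp i * real (L i) \<le> boost i / 4 ^ i * real (N i) powr \<theta>" .
qed

lemma amp_square_L: "(amp i)\<^sup>2 * real (L i) * 4 ^ i \<le> (1/4) ^ i"
proof -
  have "(amp i)\<^sup>2 * real (L i) * 4 ^ i = amp i * 4 ^ i * (amp i * real (L i))"
    by (simp add: power2_eq_square)
  also have "\<dots> \<le> amp i * 4 ^ i * (boost i / 4 ^ i * real (N i) powr \<theta>)"
    by (intro mult_left_mono amp_L_bounds) (auto intro: less_imp_le)
  also have "\<dots> = (1/4)^i / 2"
    using boost_pos[of i] by (simp add: amp_def powr_minus field_simps power_one_over)
  finally show ?thesis by (simp add: field_simps)
qed

section \<open>Summation by blocks\<close>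

lemma block_index_eq: assumes "N i \<le> n" "n < N (Suc i)" shows "block_index n = i"
  unfolding block_index_def
proof (rule Least_equality)
  fix j assume "n < N (Suc j)"
  show "i \<le> j"
  proof (rule ccontr)
    assume "\<not> i \<le> j"
    then have "N (Suc j) \<le> N i" by (intro N_mono) auto
    then show False using assms \<open>n < N (Suc j)\<close> by linarith
  qed
qed fact

lemma coeff_eq_0: assumes "n < N 0" shows "coeff n = 0"
proof -
  have "block_index n = 0" unfolding block_index_def
    using assms N_mono[of 0 1] by (intro Least_eq_0) simp
  then show ?thesis using assms by (simp add: coeff_def block_coeff_eq_0)
qed

lemma block_sum:
  fixes h :: "nat \<Rightarrow> complex \<Rightarrow> 'a :: comm_monoid_add"
  assumes "\<And>n. h n 0 = 0"
  shows "(\<Sum>n\<in>{N i..<N (Suc i)}. h n (coeff n))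
     = (\<Sum>k\<le>i. \<Sum>l<L i. h (N i + k * (4 * L i) + l) (of_real (amp i * ((-1) ^ k * real (i choose k)))))"
proof -
  have "N i + Suc i * (4 * L i) \<le> N (Suc i)" using L_N'[of i] two_N_le[of i] by linarith
  from sum_block_coeff[OF _ this, of "\<lambda>n x. h n (of_real (amp i * x))"] assms
  have "(\<Sum>n\<in>{N i..<N (Suc i)}. h n (of_real (amp i * block_coeff (N i) (L i) i n)))
     = (\<Sum>k\<le>i. \<Sum>l<L i. h (N i + k * (4 * L i) + l) (of_real (amp i * ((-1) ^ k * real (i choose k)))))"
    by simp
  moreover have "(\<Sum>n\<in>{N i..<N (Suc i)}. h n (coeff n))
     = (\<Sum>n\<in>{N i..<N (Suc i)}. h n (of_real (amp i * block_coeff (N i) (L i) i n)))"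
    by (intro sum.cong refl) (auto simp: coeff_def block_index_eq)
  ultimately show ?thesis by simp
qed

lemma sum_up_to_N:
  fixes h :: "nat \<Rightarrow> 'a :: comm_monoid_add"
  assumes "\<And>n. n < N 0 \<Longrightarrow> h n = 0"
  shows "(\<Sum>n<N j. h n) = (\<Sum>i<j. \<Sum>n\<in>{N i..<N (Suc i)}. h n)"
proof (induction j)
  case 0
  then show ?case using assms by simp
next
  case (Suc j)
  have "(\<Sum>n<N (Suc j). h n) = (\<Sum>n<N j. h n) + (\<Sum>n\<in>{N j..<N (Suc j)}. h n)"
    using sum.atLeastLessThan_concat[of 0 "N j" "N (Suc j)" h] N_mono[of j "Suc j"]
    by (simp add: atLeast0LessThan)
  then show ?case using Suc by simp
qed

lemma summable_by_blocks:
  fixes h :: "nat \<Rightarrow> real"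
  assumes "\<And>n. h n \<ge> 0" "\<And>n. n < N 0 \<Longrightarrow> h n = 0"
    and "\<And>i. (\<Sum>n\<in>{N i..<N (Suc i)}. h n) \<le> B i" "summable B"
  shows "summable h"
proof (rule summableI_nonneg_bounded)
  fix j
  have "j \<le> N j" by (rule seq_suble[OF N_strict_mono])
  then have "(\<Sum>n<j. h n) \<le> (\<Sum>n<N j. h n)"
    using assms(1) by (intro sum_mono2) auto
  also have "\<dots> \<le> (\<Sum>i<j. B i)"
    using assms(2,3) by (simp add: sum_up_to_N sum_mono)
  also have "\<dots> \<le> suminf B"
  proof (rule sum_le_suminf[OF assms(4)])
    fix i
    have "0 \<le> (\<Sum>n\<in>{N i..<N (Suc i)}. h n)" using assms(1) by (rule sum_nonneg)
    then show "0 \<le> B i" using assms(3)[of i] by linarith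
  qed simp
  finally show "(\<Sum>n<j. h n) \<le> suminf B" .
qed (rule assms(1))

lemma coeff_in_H2: "coeff \<in> hardy_H2"
proof -
  have "summable (\<lambda>n. (cmod (coeff n))\<^sup>2)"
  proof (rule summable_by_blocks)
    fix i
    have sq: "real (\<Sum>k\<le>i. (i choose k)\<^sup>2) \<le> 4 ^ i"
    proof -
      have "(\<Sum>k\<le>i. (i choose k)\<^sup>2) \<le> (\<Sum>k\<le>i. (i choose k) * 2 ^ i)"
        unfolding power2_eq_square using binomial_le_pow2[of i]
        by (intro sum_mono mult_left_mono) auto
      also have "\<dots> = 4 ^ i"
        by (simp add: choose_row_sum flip: sum_distrib_right power_mult_distrib)
      finally have "real (\<Sum>k\<le>i. (i choose k)\<^sup>2) \<le> real (4 ^ i)" by (rule of_nat_mono)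
      then show ?thesis by simp
    qed
    have "(\<Sum>n\<in>{N i..<N (Suc i)}. (cmod (coeff n))\<^sup>2)
      = (\<Sum>k\<le>i. \<Sum>l<L i. (amp i * real (i choose k))\<^sup>2)"
      by (subst block_sum[where h = "\<lambda>_ x. (cmod x)\<^sup>2"])
         (auto simp: abs_mult power_mult_distrib norm_mult norm_power)
    also have "\<dots> = (amp i)\<^sup>2 * real (L i) * real (\<Sum>k\<le>i. (i choose k)\<^sup>2)"
      by (simp add: power_mult_distrib sum_distrib_left mult_ac)
    also have "\<dots> \<le> (amp i)\<^sup>2 * real (L i) * 4 ^ i"
      by (intro mult_left_mono sq) auto
    also have "\<dots> \<le> (1/4) ^ i" by (rule amp_square_L)
    finally show "(\<Sum>n\<in>{N i..<N (Suc i)}. (cmod (coeff n))\<^sup>2) \<le> (1/4) ^ i" .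
  qed (auto simp: coeff_eq_0 intro!: summable_geometric)
  then have "summable (\<lambda>k. (cmod (coeff (Suc k)))\<^sup>2)" by (subst summable_Suc_iff)
  then show ?thesis by (simp add: hardy_H2_def)
qed

section \<open>Bounds for the blocks\<close>

text \<open>The logarithm of the left-hand side is of size \<open>j ^ 3\<close>, that of the right-hand side of size \<open>4 ^ j\<close>. The left-hand side
collects all factors of the cancellation estimate other than powers of \<open>N\<close> and of the height.\<close>
lemma factor_subpolynomial:
  assumes "\<delta> > 0" "K \<ge> 1"
  shows "\<exists>C>0. \<forall>j. boost j * (8 * (boost j)\<^sup>2 * (K + real j)) ^ j \<le> C * real (N j) powr \<delta>"
proof -
  define c where "c = \<delta> * real q"
  have c: "c > 0" using assms q_pos by (simp add: c_def)
  define r where "r j = 8^(j^2) * (8 * 64^(j^2) * (K + real j))^j / 2 powr (c * 4^j)" for j :: nat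
  have "r \<longlonglongrightarrow> 0" unfolding r_def using c assms by real_asymp
  then have "Bseq r" by (intro convergent_imp_Bseq convergentI)
  then obtain C where C: "C > 0" "\<And>j. norm (r j) \<le> C" by (auto elim: BseqE)
  have "boost j * (8 * (boost j)\<^sup>2 * (K + real j)) ^ j \<le> C * real (N j) powr \<delta>" for j
  proof -
    have "(boost j)\<^sup>2 = 64 ^ (j\<^sup>2)" unfolding boost_def by (simp add: mult.commute flip: power_mult) (simp add: power_mult)
    then have "boost j * (8 * (boost j)\<^sup>2 * (K + real j)) ^ j = r j * real (N j) powr \<delta>"
      by (simp add: r_def boost_def N_powr c_def)
    also have "\<dots> \<le> C * real (N j) powr \<delta>"
      using C(2)[of j] by (intro mult_right_mono) auto
    finally show ?thesis .
  qed
  with C(1) show ?thesis by blast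
qed

lemma boost_subpolynomial:
  assumes "\<delta> > 0"
  shows "\<exists>C>0. \<forall>j. boost j \<le> C * real (N j) powr \<delta>"
proof -
  obtain C where C: "C > 0" "\<And>j. boost j * (8 * (boost j)\<^sup>2 * (1 + real j)) ^ j \<le> C * real (N j) powr \<delta>"
    using factor_subpolynomial[OF assms, of 1] by auto
  have "boost j \<le> C * real (N j) powr \<delta>" for j
  proof -
    have "1 * 1 \<le> 8 * (boost j)\<^sup>2 * (1 + real j)"
      using one_le_power[OF boost_ge_1[of j], of 2] by (intro mult_mono) auto
    then have "boost j * 1 \<le> boost j * (8 * (boost j)\<^sup>2 * (1 + real j)) ^ j"
      using boost_pos[of j] by (intro mult_left_mono one_le_power) auto
    then show ?thesis using C(2)[of j] by linarith
  qed
  with C(1) show ?thesis by blast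
qed

lemma block_abs_sum_le:
  assumes "\<kappa> \<le> \<sigma>"
  shows "(\<Sum>k\<le>i. \<Sum>l<L i. amp i * real (i choose k) * real (N i + k * (4 * L i) + l) powr (- \<sigma>))
         \<le> 2 powr \<bar>\<kappa>\<bar> * (boost i * (1/2) ^ i * real (N i) powr (\<theta> - \<kappa>))"
proof -
  have "(\<Sum>k\<le>i. \<Sum>l<L i. amp i * real (i choose k) * real (N i + k * (4 * L i) + l) powr (- \<sigma>))
     = amp i * (\<Sum>k\<le>i. \<Sum>l<L i. real (i choose k) * real (N i + k * (4 * L i) + l) powr (- \<sigma>))"
    by (simp add: sum_distrib_left mult_ac)
  also have "\<dots> \<le> amp i * (2 ^ i * real (L i) * (2 powr \<bar>\<kappa>\<bar> * real (N i) powr (- \<kappa>)))"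
    by (intro mult_left_mono sum_powr_block_le L_N' assms) (auto intro: less_imp_le)
  also have "\<dots> = (amp i * real (L i)) * (2 ^ i * (2 powr \<bar>\<kappa>\<bar> * real (N i) powr (- \<kappa>)))"
    by simp
  also have "\<dots> \<le> (boost i / 4 ^ i * real (N i) powr \<theta>) * (2 ^ i * (2 powr \<bar>\<kappa>\<bar> * real (N i) powr (- \<kappa>)))"
    by (intro mult_right_mono amp_L_bounds) auto
  also have "\<dots> = 2 powr \<bar>\<kappa>\<bar> * (boost i * (1/2) ^ i * real (N i) powr (\<theta> - \<kappa>))"
  proof -
    have "(4::real) ^ i = 2 ^ i * 2 ^ i" by (simp flip: power_mult_distrib)
    moreover have "real (N i) powr (\<theta> - \<kappa>) = real (N i) powr \<theta> * real (N i) powr (- \<kappa>)"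
      by (simp flip: powr_add)
    ultimately show ?thesis by (simp add: power_one_over field_simps)
  qed
  finally show ?thesis .
qed

lemma block_le_trivial:
  assumes "\<kappa> \<le> Re s"
  shows "cmod (blk i s) \<le> 2 powr \<bar>\<kappa>\<bar> * (boost i * (1/2) ^ i * real (N i) powr (\<theta> - \<kappa>))"
proof -
  have "cmod (blk i s) \<le> (\<Sum>k\<le>i. \<Sum>l<L i. cmod (of_real (amp i) * ((-1) ^ k * of_nat (i choose k) * of_nat (N i + k * (4 * L i) + l) powr (- s))))"
    unfolding blk_def block_poly_def sum_distrib_left
    by (intro order_trans[OF norm_sum] sum_mono norm_sum)
  also have "\<dots> = (\<Sum>k\<le>i. \<Sum>l<L i. amp i * real (i choose k) * real (N i + k * (4 * L i) + l) powr (- Re s))"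
    by (intro sum.cong refl)
       (auto simp: norm_mult norm_power norm_of_nat_powr abs_of_pos simp del: of_nat_add)
  also have "\<dots> \<le> 2 powr \<bar>\<kappa>\<bar> * (boost i * (1/2) ^ i * real (N i) powr (\<theta> - \<kappa>))"
    by (rule block_abs_sum_le[OF assms])
  finally show ?thesis .
qed

lemma block_le_cancellation:
  assumes "\<kappa> \<le> Re s" "0 \<le> \<kappa> + real i"
  shows "cmod (blk i s) \<le> boost i * (1/4) ^ i * real (N i) powr (\<theta> - \<kappa>)
           * (8 * (boost i)\<^sup>2 * (cmod s + real i) * real (N i) powr (- v)) ^ i"
proof -
  have "cmod (blk i s) = amp i * cmod (block_poly (N i) (L i) i s)"
    by (simp add: blk_def norm_mult abs_of_pos)
  also have "\<dots> \<le> amp i * (real (L i) * ((4 * real (L i)) ^ i * ((cmod s + real i) ^ i * real (N i) powr (- \<kappa> - real i))))"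
    by (intro mult_left_mono norm_block_poly_cancellation assms) (auto intro: less_imp_le)
  also have "\<dots> = (amp i * real (L i)) * (real (N i) powr (- \<kappa>) * ((4 * real (L i) / real (N i)) * (cmod s + real i)) ^ i)"
    by (simp add: powr_diff powr_realpow power_mult_distrib power_divide)
  also have "\<dots> \<le> (boost i / 4 ^ i * real (N i) powr \<theta>) *
      (real (N i) powr (- \<kappa>) * ((8 * (boost i)\<^sup>2 * real (N i) powr (- v)) * (cmod s + real i)) ^ i)"
    by (intro mult_mono amp_L_bounds power_mono mult_right_mono four_L_div_N order_refl) (auto intro!: mult_nonneg_nonneg less_imp_le)
  also have "\<dots> = boost i * (1/4) ^ i * real (N i) powr (\<theta> - \<kappa>)
           * (8 * (boost i)\<^sup>2 * (cmod s + real i) * real (N i) powr (- v)) ^ i"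
  proof -
    have "real (N i) powr (\<theta> - \<kappa>) = real (N i) powr \<theta> * real (N i) powr (- \<kappa>)"
      by (simp flip: powr_add)
    then show ?thesis by (simp add: power_one_over field_simps)
  qed
  finally show ?thesis .
qed

lemma block_ge:
  "cmod (blk i (Complex \<sigma> (pi * real (N i) / (4 * real (L i)))))
     \<ge> 2 powr (- \<bar>\<sigma>\<bar>) / 4 * (boost i / 4 ^ i * real (N i) powr (\<theta> - \<sigma>))"
proof -
  have "2 powr (- \<bar>\<sigma>\<bar>) / 4 * (boost i / 4 ^ i * real (N i) powr (\<theta> - \<sigma>))
     = (boost i / 4 ^ i / 2 * real (N i) powr \<theta>) * (2 powr (- \<bar>\<sigma>\<bar>) * real (N i) powr (- \<sigma>) / 2)"
  proof -
    have "real (N i) powr (\<theta> - \<sigma>) = real (N i) powr \<theta> * real (N i) powr (- \<sigma>)"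
      by (simp flip: powr_add)
    then show ?thesis by simp
  qed
  also have "\<dots> \<le> amp i * real (L i) * (2 powr (- \<bar>\<sigma>\<bar>) * real (N i) powr (- \<sigma>) / 2)"
    by (intro mult_right_mono amp_L_bounds) auto
  also have "\<dots> \<le> amp i * cmod (block_poly (N i) (L i) i (Complex \<sigma> (pi * real (N i) / (4 * real (L i)))))"
    using norm_block_poly_ge[OF L_pos L_N refl, of i \<sigma>] less_imp_le[OF amp_pos[of i]]
    by (simp only: mult.assoc mult_left_mono)
  also have "\<dots> = cmod (blk i (Complex \<sigma> (pi * real (N i) / (4 * real (L i)))))"
    by (simp add: blk_def norm_mult abs_of_pos)
  finally show ?thesis .
qed

section \<open>Convergence of the Dirichlet series\<close>

lemma summable_coeff_above_theta:
  assumes "Re s > \<theta>"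
  shows "summable (\<lambda>n. cmod (coeff n * of_nat n powr (- s)))"
proof -
  let ?\<delta> = "Re s - \<theta>"
  obtain C where C: "C > 0" "\<And>j. boost j \<le> C * real (N j) powr ?\<delta>"
    using boost_subpolynomial[of ?\<delta>] assms by auto
  show ?thesis
  proof (rule summable_by_blocks)
    fix i
    have "(\<Sum>n\<in>{N i..<N (Suc i)}. cmod (coeff n * of_nat n powr (- s)))
      = (\<Sum>k\<le>i. \<Sum>l<L i. amp i * real (i choose k) * real (N i + k * (4 * L i) + l) powr (- Re s))"
      by (subst block_sum[where h = "\<lambda>n x. cmod (x * of_nat n powr (- s))"])
         (auto simp: norm_mult norm_power norm_of_nat_powr abs_mult abs_of_pos simp del: of_nat_add)
    also have "\<dots> \<le> 2 powr \<bar>Re s\<bar> * (boost i * (1/2) ^ i * real (N i) powr (\<theta> - Re s))"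
      by (rule block_abs_sum_le) simp
    also have "\<dots> \<le> 2 powr \<bar>Re s\<bar> * (C * real (N i) powr ?\<delta> * (1/2) ^ i * real (N i) powr (\<theta> - Re s))"
      by (intro mult_left_mono mult_right_mono C) auto
    also have "\<dots> = 2 powr \<bar>Re s\<bar> * C * (1/2) ^ i * (real (N i) powr ?\<delta> * real (N i) powr (\<theta> - Re s))"
      by simp
    also have "\<dots> = 2 powr \<bar>Re s\<bar> * C * (1/2) ^ i"
      by (simp flip: powr_add)
    finally show "(\<Sum>n\<in>{N i..<N (Suc i)}. cmod (coeff n * of_nat n powr (- s)))
       \<le> 2 powr \<bar>Re s\<bar> * C * (1/2) ^ i" .
  qed (auto simp: coeff_eq_0 intro!: summable_mult summable_geometric)
qed

lemma sum_block_dirichlet: "(\<Sum>n\<in>{N i..<N (Suc i)}. coeff n * of_nat n powr (- s)) = blk i s"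
  by (subst block_sum[where h = "\<lambda>n x. x * of_nat n powr (- s)"])
     (auto simp: blk_def block_poly_def sum_distrib_left mult_ac)

text \<open>The series converges absolutely, so its sum is the limit along the partial sums that end with a full block.\<close>
lemma dirichlet_sums_F:
  assumes "Re s > \<theta>"
  shows "dirichlet_term coeff s sums F s"
proof -
  let ?h = "\<lambda>n. coeff n * of_nat n powr (- s)"
  have "summable ?h"
    using summable_coeff_above_theta[OF assms] by (rule summable_norm_cancel)
  then have h: "?h sums suminf ?h" by (rule summable_sums)
  have "(\<lambda>j. \<Sum>n<N j. ?h n) \<longlonglongrightarrow> suminf ?h"
    using LIMSEQ_subseq_LIMSEQ[OF h[unfolded sums_def] N_strict_mono] by (simp add: o_def)
  moreover have "(\<Sum>n<N j. ?h n) = (\<Sum>i<j. blk i s)" for j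
    by (subst sum_up_to_N) (auto simp: coeff_eq_0 sum_block_dirichlet)
  ultimately have "(\<lambda>i. blk i s) sums suminf ?h" by (simp add: sums_def)
  then have "F s = suminf ?h" unfolding F_def by (rule sums_unique[symmetric])
  moreover have "(\<lambda>k. ?h (Suc k)) sums suminf ?h"
    using h by (subst sums_Suc_iff) (simp add: coeff_eq_0)
  ultimately show ?thesis by (simp add: dirichlet_term_def[abs_def])
qed

lemma filterlim_boost_div_4: "filterlim (\<lambda>i. boost i / 4 ^ i) at_top sequentially"
  unfolding boost_def by real_asymp

text \<open>At a fixed \<open>s\<close>, the first run of a block is coherent as soon as \<open>\<bar>Im s\<bar> * L i \<le> N i\<close>. Its sum is then of size
\<open>boost i / 4 ^ i\<close> at least, up to a constant, against the Cauchy criterion.\<close>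
lemma not_summable_below_theta:
  assumes "Re s \<le> \<theta>"
  shows "\<not> summable (dirichlet_term coeff s)"
proof
  assume "summable (dirichlet_term coeff s)"
  then have "summable (\<lambda>n. coeff n * of_nat n powr (- s))"
    unfolding dirichlet_term_def[abs_def]
    by (subst (asm) summable_Suc_iff[where f = "\<lambda>n. coeff n * of_nat n powr (- s)"])
  then obtain n0 where n0: "\<And>m n. n0 \<le> m \<Longrightarrow> cmod (\<Sum>i\<in>{m..<n}. coeff i * of_nat i powr (- s)) < 1"
    unfolding summable_Cauchy by (metis zero_less_one)
  define c where "c = 2 powr (- \<bar>Re s\<bar>) / 4"
  have c: "c > 0" by (simp add: c_def)
  have "eventually (\<lambda>i. boost i / 4 ^ i \<ge> 1 / c) sequentially"
    using filterlim_boost_div_4 by (simp add: filterlim_at_top)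
  moreover have "eventually (\<lambda>i. real i \<ge> \<bar>Im s\<bar>) sequentially" by real_asymp
  moreover have "eventually (\<lambda>i. i \<ge> n0) sequentially" by (rule eventually_ge_at_top)
  ultimately have "eventually (\<lambda>i. boost i / 4 ^ i \<ge> 1 / c \<and> real i \<ge> \<bar>Im s\<bar> \<and> i \<ge> n0) sequentially"
    by eventually_elim simp
  then obtain i where i: "boost i / 4 ^ i \<ge> 1 / c" "real i \<ge> \<bar>Im s\<bar>" "i \<ge> n0"
    by (auto simp: eventually_at_top_linorder)
  have LN: "L i \<le> N i" "i * L i \<le> N i" using L_N'[of i] by auto
  have "i \<le> N i" by (rule seq_suble[OF N_strict_mono])
  have "\<bar>Im s\<bar> * real (L i) \<le> real i * real (L i)" using i by (intro mult_right_mono) auto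
  also have "\<dots> \<le> real (N i)" using LN(2) by (simp flip: of_nat_mult)
  finally have tL: "\<bar>Im s\<bar> * real (L i) \<le> real (N i)" .
  have "1 \<le> c * (boost i / 4 ^ i)" using i(1) c by (simp add: field_simps)
  also have "\<dots> = c * (boost i / 4 ^ i) * 1" by simp
  also have "\<dots> \<le> c * (boost i / 4 ^ i) * real (N i) powr (\<theta> - Re s)"
    using c assms by (intro mult_left_mono N_powr_ge_1) auto
  also have "\<dots> = (boost i / 4 ^ i / 2 * real (N i) powr \<theta>) * (2 powr (- \<bar>Re s\<bar>) * real (N i) powr (- Re s) / 2)"
  proof -
    have "real (N i) powr (\<theta> - Re s) = real (N i) powr \<theta> * real (N i) powr (- Re s)"
      by (simp flip: powr_add)
    then show ?thesis by (simp add: c_def)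
  qed
  also have "\<dots> \<le> amp i * real (L i) * (2 powr (- \<bar>Re s\<bar>) * real (N i) powr (- Re s) / 2)"
    by (intro mult_right_mono amp_L_bounds) auto
  also have "\<dots> \<le> amp i * cmod (\<Sum>l<L i. of_nat (N i + l) powr (- Complex (Re s) (Im s)))"
    unfolding mult.assoc
    by (intro mult_left_mono norm_block_front_ge LN tL) (auto intro: less_imp_le)
  also have "\<dots> = cmod (\<Sum>l<L i. of_real (amp i) * of_nat (N i + l) powr (- s))"
    by (simp add: norm_mult abs_of_pos flip: sum_distrib_left)
  also have "(\<Sum>l<L i. of_real (amp i) * of_nat (N i + l) powr (- s))
      = (\<Sum>l<L i. coeff (N i + l) * of_nat (N i + l) powr (- s))"
  proof (intro sum.cong refl)
    fix l assume l: "l \<in> {..<L i}"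
    have "N i + l < N (Suc i)" using l L_N'[of i] two_N_le[of i] by auto
    then have "block_index (N i + l) = i" by (intro block_index_eq) auto
    then show "of_real (amp i) * of_nat (N i + l) powr (- s) = coeff (N i + l) * of_nat (N i + l) powr (- s)"
      using l by (simp add: coeff_def block_coeff_def)
  qed
  also have "\<dots> = (\<Sum>n\<in>{N i..<N i + L i}. coeff n * of_nat n powr (- s))"
    by (subst sum.atLeastLessThan_shift_0) (simp add: atLeast0LessThan)
  finally show False using n0[of "N i" "N i + L i"] \<open>i \<le> N i\<close> i(3) by simp
qed

lemma conv_abscissa_coeff: "conv_abscissa coeff = ereal \<theta>"
  and abs_conv_abscissa_coeff: "abs_conv_abscissa coeff = ereal \<theta>"
proof -
  have abs_summable: "summable (\<lambda>k. cmod (dirichlet_term coeff s k))" if "Re s > \<theta>" for s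
    using summable_coeff_above_theta[OF that]
    unfolding dirichlet_term_def by (subst (asm) summable_Suc_iff[symmetric])
  have le: "conv_abscissa coeff \<le> abs_conv_abscissa coeff"
    unfolding conv_abscissa_def abs_conv_abscissa_def
    by (intro Inf_superset_mono) (auto intro: summable_norm_cancel)
  have ge: "ereal \<theta> \<le> conv_abscissa coeff"
    unfolding conv_abscissa_def using not_summable_below_theta
    by (intro Inf_greatest) (auto, metis linear)
  have "abs_conv_abscissa coeff \<le> ereal \<theta>"
  proof (rule ereal_le_epsilon2)
    fix \<epsilon> :: real assume "\<epsilon> > 0"
    then have "ereal (\<theta> + \<epsilon>) \<in> {ereal (Re s) |s. summable (\<lambda>k. cmod (dirichlet_term coeff s k))}"
      using abs_summable[of "Complex (\<theta> + \<epsilon>) 0"] by (auto intro!: exI[of _ "Complex (\<theta> + \<epsilon>) 0"])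
    then show "abs_conv_abscissa coeff \<le> ereal \<theta> + ereal \<epsilon>"
      unfolding abs_conv_abscissa_def by (auto intro!: Inf_lower)
  qed
  with le ge show "conv_abscissa coeff = ereal \<theta>" "abs_conv_abscissa coeff = ereal \<theta>"
    by (auto intro: order_antisym order_trans)
qed

section \<open>The entire extension and its growth\<close>

text \<open>Below, \<open>A\<close> is the exponent and \<open>T = 1 + \<bar>Im s\<bar>\<close>. If \<open>N powr v \<le> T\<close>, the trivial bound
\<open>N powr (\<theta> - \<kappa>)\<close> is at most \<open>T powr A\<close>. If \<open>N powr v > T\<close> and \<open>j \<ge> A\<close>, cancellation
gives \<open>(N powr v) powr A * (T / N powr v) ^ j \<le> T powr A\<close>. The \<open>\<epsilon>\<close> absorbs the subpolynomial factors. The finitely many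
\<open>j < A\<close> are included in the first case through the constant \<open>Y\<close>. For \<open>Re s > 1\<close>, where \<open>\<bar>s\<bar>\<close> is not controlled by
\<open>T\<close>, the trivial bound suffices.\<close>
lemma block_uniform_bound:
  assumes "\<kappa> \<le> \<theta>" "\<epsilon> > 0"
  shows "\<exists>C>0. \<forall>i s. \<kappa> \<le> Re s \<longrightarrow>
           cmod (blk i s) \<le> C * (1 + \<bar>Im s\<bar>) powr ((\<theta> - \<kappa>) / v + \<epsilon>) * (1/2) ^ i"
proof -
  define A where "A = (\<theta> - \<kappa>) / v + \<epsilon>"
  define K where "K = \<bar>\<kappa>\<bar> + 1"
  define Y where "Y = real (N (nat \<lceil>A\<rceil>)) powr v"
  have A: "A > 0" unfolding A_def using assms v_pos by (intro add_nonneg_pos divide_nonneg_pos) auto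
  have "- \<kappa> \<le> (\<theta> - \<kappa>) * 1" using theta_pos by simp
  also have "\<dots> \<le> (\<theta> - \<kappa>) * (1 / v)" using assms v_pos v_le_1 by (intro mult_left_mono) auto
  finally have A_kappa: "- \<kappa> \<le> A" using assms(2) by (simp add: A_def)
  have vA: "v * A = \<theta> - \<kappa> + v * \<epsilon>" using v_pos by (simp add: A_def field_simps)
  have Y: "Y \<ge> 1" unfolding Y_def using v_pos by (intro N_powr_ge_1) auto
  obtain C0 where C0: "C0 > 0" "\<And>j. boost j * (8 * (boost j)\<^sup>2 * (K + real j)) ^ j \<le> C0 * real (N j) powr (v * \<epsilon>)"
    using factor_subpolynomial[of "v * \<epsilon>" K] assms v_pos by (auto simp: K_def)
  obtain C1 where C1: "C1 > 0" "\<And>j. boost j \<le> C1 * real (N j) powr (v * \<epsilon>)"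
    using boost_subpolynomial[of "v * \<epsilon>"] assms v_pos by auto
  obtain C2 where C2: "C2 > 0" "\<And>j. boost j \<le> C2 * real (N j) powr (1 - \<theta>)"
    using boost_subpolynomial[of "1 - \<theta>"] theta_less_half by auto
  define C where "C = C0 + 2 powr \<bar>\<kappa>\<bar> * C1 * Y powr A + 2 * C2"
  have pos: "2 powr \<bar>\<kappa>\<bar> * C1 * Y powr A \<ge> 0" using C1 by simp
  have C: "C > 0" using C0(1) C2(1) pos unfolding C_def by linarith
  have C_ge: "C0 \<le> C" "2 powr \<bar>\<kappa>\<bar> * C1 * Y powr A \<le> C" "2 * C2 \<le> C"
    using C0(1) C2(1) pos unfolding C_def by linarith+
  have "cmod (blk j s) \<le> C * (1 + \<bar>Im s\<bar>) powr A * (1/2) ^ j" if s: "\<kappa> \<le> Re s" for j s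
  proof -
    define T where "T = 1 + \<bar>Im s\<bar>"
    have T: "T \<ge> 1" "T > 0" by (simp_all add: T_def)
    have TA: "T powr A \<ge> 1" using T A by (intro ge_one_powr_ge_zero) auto
    have N_A: "(real (N j) powr v) powr A = real (N j) powr (v * \<epsilon>) * real (N j) powr (\<theta> - \<kappa>)"
      by (simp add: powr_powr vA add.commute flip: powr_add)
    consider "Re s > 1" | "real (N j) powr v \<le> Y * T"
      | "Re s \<le> 1" "real (N j) powr v > Y * T" by linarith
    then have "cmod (blk j s) \<le> C * T powr A * (1/2) ^ j"
    proof cases
      case 1
      then have "cmod (blk j s) \<le> 2 powr \<bar>1\<bar> * (boost j * (1/2) ^ j * real (N j) powr (\<theta> - 1))"
        by (intro block_le_trivial) auto
      also have "\<dots> \<le> 2 powr \<bar>1\<bar> * ((C2 * real (N j) powr (1 - \<theta>)) * (1/2) ^ j * real (N j) powr (\<theta> - 1))"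
        by (intro mult_left_mono mult_right_mono C2) auto
      also have "\<dots> = 2 * C2 * (1/2) ^ j * (real (N j) powr (1 - \<theta>) * real (N j) powr (\<theta> - 1))"
        by simp
      also have "\<dots> = 2 * C2 * 1 * (1/2) ^ j"
        by (simp flip: powr_add)
      also have "\<dots> \<le> C * T powr A * (1/2) ^ j"
        using C_ge C2(1) C TA by (intro mult_right_mono mult_mono) auto
      finally show ?thesis .
    next
      case 2
      have "cmod (blk j s) \<le> 2 powr \<bar>\<kappa>\<bar> * (boost j * (1/2) ^ j * real (N j) powr (\<theta> - \<kappa>))"
        by (intro block_le_trivial s)
      also have "\<dots> \<le> 2 powr \<bar>\<kappa>\<bar> * ((C1 * real (N j) powr (v * \<epsilon>)) * (1/2) ^ j * real (N j) powr (\<theta> - \<kappa>))"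
        by (intro mult_left_mono mult_right_mono C1) auto
      also have "\<dots> = 2 powr \<bar>\<kappa>\<bar> * C1 * (real (N j) powr v) powr A * (1/2) ^ j"
        by (simp add: N_A)
      also have "\<dots> \<le> 2 powr \<bar>\<kappa>\<bar> * C1 * (Y * T) powr A * (1/2) ^ j"
        using 2 A C1(1) by (intro mult_left_mono mult_right_mono powr_mono2) auto
      also have "\<dots> = (2 powr \<bar>\<kappa>\<bar> * C1 * Y powr A) * T powr A * (1/2) ^ j"
        using Y T by (simp add: powr_mult)
      also have "\<dots> \<le> C * T powr A * (1/2) ^ j"
        using C_ge by (intro mult_right_mono) auto
      finally show ?thesis .
    next
      case 3
      have "Y * 1 \<le> Y * T" using Y T by (intro mult_left_mono) auto
      with 3 have "real (N (nat \<lceil>A\<rceil>)) powr v < real (N j) powr v"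
        unfolding Y_def by linarith
      moreover have "real (N j) powr v \<le> real (N (nat \<lceil>A\<rceil>)) powr v" if "j \<le> nat \<lceil>A\<rceil>"
        using N_mono[OF that] v_pos by (intro powr_mono2) auto
      ultimately have "\<not> j \<le> nat \<lceil>A\<rceil>" by (meson not_le)
      then have jA: "A \<le> real j" by linarith
      have "1 * T \<le> Y * T" using Y T by (intro mult_right_mono) auto
      with 3 have TN: "T \<le> real (N j) powr v" by simp
      have "cmod s \<le> \<bar>Re s\<bar> + \<bar>Im s\<bar>" by (rule cmod_le)
      also have "\<bar>Re s\<bar> \<le> K" using 3 s by (auto simp: K_def)
      also have "K + \<bar>Im s\<bar> \<le> K * T" by (simp add: K_def T_def algebra_simps)
      finally have "cmod s + real j \<le> K * T + real j * T"
        using T by (intro add_mono) (auto simp: mult_le_cancel_left1)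
      then have sT: "cmod s + real j \<le> (K + real j) * T" by (simp add: algebra_simps)
      have "cmod (blk j s) \<le> boost j * (1/4) ^ j * real (N j) powr (\<theta> - \<kappa>)
           * (8 * (boost j)\<^sup>2 * (cmod s + real j) * real (N j) powr (- v)) ^ j"
        using jA A_kappa by (intro block_le_cancellation s) auto
      also have "\<dots> \<le> boost j * (1/4) ^ j * real (N j) powr (\<theta> - \<kappa>)
           * (8 * (boost j)\<^sup>2 * ((K + real j) * T) * real (N j) powr (- v)) ^ j"
        by (intro mult_left_mono mult_right_mono power_mono sT) auto
      also have "\<dots> = (boost j * (8 * (boost j)\<^sup>2 * (K + real j)) ^ j) * (1/4) ^ j * real (N j) powr (\<theta> - \<kappa>)
           * (T * real (N j) powr (- v)) ^ j"
        by (simp add: power_mult_distrib)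
      also have "\<dots> \<le> (C0 * real (N j) powr (v * \<epsilon>)) * (1/4) ^ j * real (N j) powr (\<theta> - \<kappa>)
           * (T * real (N j) powr (- v)) ^ j"
        using T by (intro mult_right_mono C0) auto
      also have "\<dots> = C0 * (1/4) ^ j * (real (N j) powr v) powr A * (T / real (N j) powr v) ^ j"
        unfolding N_A powr_minus divide_inverse by (simp only: mult_ac)
      also have "(T / real (N j) powr v) ^ j = (T / real (N j) powr v) powr real j"
        using T by (subst powr_realpow) auto
      also have "C0 * (1/4) ^ j * (real (N j) powr v) powr A * (T / real (N j) powr v) powr real j
         \<le> C0 * (1/4) ^ j * (real (N j) powr v) powr A * (T / real (N j) powr v) powr A"
        using TN T jA C0(1) by (intro mult_left_mono powr_mono') auto
      also have "\<dots> = C0 * T powr A * (1/4) ^ j"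
        using T by (simp add: powr_divide)
      also have "\<dots> \<le> C * T powr A * (1/2) ^ j"
        using C_ge C by (intro mult_mono power_mono) auto
      finally show ?thesis .
    qed
    then show ?thesis by (simp add: T_def)
  qed
  with C show ?thesis unfolding A_def by blast
qed

lemma F_bound:
  assumes "\<kappa> \<le> \<theta>" "\<epsilon> > 0"
  shows "\<exists>C>0. \<forall>s. \<kappa> \<le> Re s \<longrightarrow> cmod (F s) \<le> C * (1 + \<bar>Im s\<bar>) powr ((\<theta> - \<kappa>) / v + \<epsilon>)"
proof -
  obtain C where C: "C > 0" "\<And>i s. \<kappa> \<le> Re s \<Longrightarrow>
      cmod (blk i s) \<le> C * (1 + \<bar>Im s\<bar>) powr ((\<theta> - \<kappa>) / v + \<epsilon>) * (1/2) ^ i"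
    using block_uniform_bound[OF assms] by blast
  have "cmod (F s) \<le> (2 * C) * (1 + \<bar>Im s\<bar>) powr ((\<theta> - \<kappa>) / v + \<epsilon>)" if "\<kappa> \<le> Re s" for s
  proof -
    let ?B = "C * (1 + \<bar>Im s\<bar>) powr ((\<theta> - \<kappa>) / v + \<epsilon>)"
    have sums: "(\<lambda>i. ?B * (1/2) ^ i) sums (?B * 2)"
      using sums_mult[OF geometric_sums[of "1/2::real"], of ?B] by simp
    have "cmod (F s) \<le> (\<Sum>i. ?B * (1/2) ^ i)"
      unfolding F_def by (rule norm_suminf_le) (use C(2)[OF that] sums in \<open>auto dest: sums_summable\<close>)
    also have "\<dots> = ?B * 2" using sums by (rule sums_unique[symmetric])
    finally show ?thesis by simp
  qed
  with C(1) show ?thesis by (intro exI[of _ "2 * C"]) auto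
qed

lemma F_summable: "summable (\<lambda>i. blk i s)"
proof -
  let ?\<kappa> = "min (Re s) \<theta>"
  obtain C where C: "C > 0" "\<And>i w. ?\<kappa> \<le> Re w \<Longrightarrow>
      cmod (blk i w) \<le> C * (1 + \<bar>Im w\<bar>) powr ((\<theta> - ?\<kappa>) / v + 1) * (1/2) ^ i"
    using block_uniform_bound[of ?\<kappa> 1] by auto
  show ?thesis
  proof (rule summable_comparison_test')
    show "summable (\<lambda>i. C * (1 + \<bar>Im s\<bar>) powr ((\<theta> - ?\<kappa>) / v + 1) * (1/2) ^ i)"
      by (intro summable_mult summable_geometric) simp
    show "cmod (blk i s) \<le> C * (1 + \<bar>Im s\<bar>) powr ((\<theta> - ?\<kappa>) / v + 1) * (1/2) ^ i" if "i \<ge> 0" for i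
      by (rule C(2)) simp
  qed
qed

lemma F_holomorphic: "F holomorphic_on UNIV"
proof (rule holomorphic_uniform_sequence)
  show "(\<lambda>s. \<Sum>i<n. blk i s) holomorphic_on UNIV" for n
    unfolding blk_def by (intro holomorphic_intros holomorphic_block_poly) auto
  fix z :: complex
  let ?\<kappa> = "min (Re z - 1) \<theta>"
  let ?A = "(\<theta> - ?\<kappa>) / v + 1"
  obtain C where C: "C > 0" "\<And>i w. ?\<kappa> \<le> Re w \<Longrightarrow>
      cmod (blk i w) \<le> C * (1 + \<bar>Im w\<bar>) powr ?A * (1/2) ^ i"
    using block_uniform_bound[of ?\<kappa> 1] by auto
  have A: "?A \<ge> 0" using v_pos by (intro add_nonneg_nonneg divide_nonneg_pos) auto
  have "uniform_limit (cball z 1) (\<lambda>n s. \<Sum>i<n. blk i s) (\<lambda>s. \<Sum>i. blk i s) sequentially"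
  proof (rule Weierstrass_m_test)
    fix i w assume "w \<in> cball z 1"
    then have d: "cmod (z - w) \<le> 1" by (simp add: dist_norm)
    have "\<bar>Re (z - w)\<bar> \<le> 1" "\<bar>Im (z - w)\<bar> \<le> 1"
      using abs_Re_le_cmod[of "z - w"] abs_Im_le_cmod[of "z - w"] d by linarith+
    then have w: "?\<kappa> \<le> Re w" "1 + \<bar>Im w\<bar> \<le> 2 + \<bar>Im z\<bar>" by auto
    have "cmod (blk i w) \<le> C * (1 + \<bar>Im w\<bar>) powr ?A * (1/2) ^ i" by (rule C(2)[OF w(1)])
    also have "\<dots> \<le> C * (2 + \<bar>Im z\<bar>) powr ?A * (1/2) ^ i"
      using C(1) w(2) A by (intro mult_right_mono mult_left_mono powr_mono2) auto
    finally show "cmod (blk i w) \<le> C * (2 + \<bar>Im z\<bar>) powr ?A * (1/2) ^ i" .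
  qed (auto intro!: summable_mult summable_geometric)
  then show "\<exists>d>0. cball z d \<subseteq> UNIV \<and>
      uniform_limit (cball z d) (\<lambda>n s. \<Sum>i<n. blk i s) F sequentially"
    unfolding F_def[abs_def] by (intro exI[of _ 1]) auto
qed auto

lemma F_entire_extension: "entire_extension coeff F"
  unfolding entire_extension_def half_plane_def
  using F_holomorphic dirichlet_sums_F theta_less_half by auto

lemma F_finite_order: "finite_order_on_half_plane F \<kappa>"
  unfolding finite_order_on_half_plane_def
proof (intro conjI allI impI)
  show "F holomorphic_on half_plane \<kappa>"
    using F_holomorphic by (rule holomorphic_on_subset) simp
  fix \<epsilon> :: real assume "\<epsilon> > 0"
  obtain C where C: "\<And>s. min \<kappa> \<theta> \<le> Re s \<Longrightarrow> cmod (F s) \<le> C * (1 + \<bar>Im s\<bar>) powr ((\<theta> - min \<kappa> \<theta>) / v + 1)"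
    using F_bound[of "min \<kappa> \<theta>" 1] by auto
  have "cmod (F (Complex \<sigma> t)) \<le> C * (1 + \<bar>t\<bar>) powr ((\<theta> - min \<kappa> \<theta>) / v + 1)"
    if "\<kappa> + \<epsilon> \<le> \<sigma>" for \<sigma> t
    using C[of "Complex \<sigma> t"] that \<open>\<epsilon> > 0\<close> by simp
  then show "\<exists>A B. \<forall>\<sigma> t. \<kappa> + \<epsilon> \<le> \<sigma> \<longrightarrow> cmod (F (Complex \<sigma> t)) \<le> B * (1 + \<bar>t\<bar>) powr A"
    by blast
qed

section \<open>The order function\<close>

definition height :: "nat \<Rightarrow> real" where "height i = pi * real (N i) / (4 * real (L i))"

lemma height_le: "height i \<le> real (N i) powr v"
proof -
  have "height i \<le> 4 * real (N i) / (4 * real (L i))"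
    unfolding height_def using pi_less_4 by (intro divide_right_mono mult_right_mono) auto
  also have "\<dots> = real (N i) / real (L i)" by simp
  also have "\<dots> \<le> real (N i) / real (N i) powr (2 * \<theta>)"
  proof (intro divide_left_mono)
    have "real (N i) powr (2 * \<theta>) * 1 \<le> real (N i) powr (2 * \<theta>) * (boost i)\<^sup>2"
      using one_le_power[OF boost_ge_1] by (intro mult_left_mono) auto
    then show "real (N i) powr (2 * \<theta>) \<le> real (L i)" using L_bounds(1)[of i] by linarith
  qed auto
  also have "\<dots> = real (N i) powr v"
    unfolding two_theta by (simp add: powr_diff)
  finally show ?thesis .
qed

lemma height_ge: "height i \<ge> real (Suc i) * pi"
proof -
  have "real (Suc i) * (4 * real (L i)) \<le> real (N i)"
    using of_nat_mono[OF L_N'[of i], where 'a = real] by (simp only: of_nat_mult of_nat_numeral)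
  then have "pi * (real (Suc i) * (4 * real (L i))) \<le> pi * real (N i)" by (intro mult_left_mono) auto
  then show ?thesis unfolding height_def
    by (subst pos_le_divide_eq) (simp, simp only: mult_ac)
qed

lemma height_at_top: "filterlim height at_top sequentially"
proof (rule filterlim_at_top_mono)
  show "filterlim (\<lambda>i. real (Suc i) * pi) at_top sequentially" by real_asymp
qed (intro always_eventually allI height_ge)

text \<open>After the boosts the total size of the blocks before the \<open>i\<close>-th is smaller than that of the \<open>i\<close>-th, namely
\<open>boost i / 4 ^ i\<close>, by the factor \<open>2 ^ i\<close>, apart from constants and powers of \<open>N i\<close>.\<close>
lemma sum_boost_le: "(\<Sum>j<i. boost j) \<le> boost i / 8 ^ i"
proof (induction i)
  case (Suc i)
  have e: "boost (Suc i) / 8 ^ Suc i = boost i * 8 ^ i"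
    by (simp add: boost_def power2_eq_square power_add field_simps)
  show ?case
  proof (cases "i = 0")
    case False
    then have i: "8 \<le> (8::real) ^ i" using power_increasing[of 1 i "8::real"] by simp
    have "(\<Sum>j<Suc i. boost j) \<le> boost i / 8 ^ i + boost i" using Suc by simp
    also have "\<dots> = boost i * (1 / 8 ^ i + 1)" by (simp add: algebra_simps)
    also have "1 / 8 ^ i + 1 \<le> (8::real) ^ i"
    proof -
      have "1 / 8 ^ i \<le> (1::real)" by simp
      then show ?thesis using i by linarith
    qed
    finally show ?thesis unfolding e by simp
  qed (simp add: boost_def)
qed simp

text \<open>At its own resonance height the \<open>i\<close>-th block dominates. Later blocks are evaluated far below their heights: for \<open>i < j\<close>
the height is at most \<open>N i powr v \<le> N j powr (v / 2)\<close>, so cancellation yields the factor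
\<open>N j powr (- (v / 2) * j)\<close>, and their sum is bounded. Earlier blocks are smaller by the boosts, also for \<open>\<sigma> = \<theta>\<close>.\<close>
lemma F_large:
  assumes "\<sigma> \<le> \<theta>"
  shows "\<forall>\<^sub>F i in sequentially. cmod (F (Complex \<sigma> (height i))) \<ge> real (N i) powr (\<theta> - \<sigma>)"
proof -
  define K where "K = \<bar>\<sigma>\<bar> + 1"
  obtain C where C: "C > 0" "\<And>j. boost j * (8 * (boost j)\<^sup>2 * (K + real j)) ^ j \<le> C * real (N j) powr 1"
    using factor_subpolynomial[of 1 K] by (auto simp: K_def)
  have tail: "cmod (blk j (Complex \<sigma> (height i))) \<le> C * (1/4) ^ j"
    if ij: "i < j" and j: "real j \<ge> - \<sigma>" "real j \<ge> 2 * (1 + \<theta> - \<sigma>) / v" for i j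
  proof -
    let ?s = "Complex \<sigma> (height i)"
    let ?y = "real (N j) powr (v / 2)"
    have y: "?y \<ge> 1" using v_pos by (intro N_powr_ge_1) auto
    have "height i \<le> real (N i) powr v" by (rule height_le)
    also have "\<dots> = (real (N i) powr 2) powr (v / 2)"
      unfolding powr_powr by simp
    also have "real (N i) powr 2 = (real (N i))\<^sup>2"
      by simp
    also have "((real (N i))\<^sup>2) powr (v / 2) = real ((N i)\<^sup>2) powr (v / 2)"
      by simp
    also have "\<dots> \<le> ?y"
      using N_square_le[OF ij] v_pos by (intro powr_mono2 of_nat_mono) auto
    finally have h: "height i \<le> ?y" .
    have "0 \<le> height i" by (simp add: height_def)
    then have "cmod ?s + real j \<le> (\<bar>\<sigma>\<bar> + real j) + height i"
      using cmod_le[of ?s] by simp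
    also have "\<dots> \<le> (\<bar>\<sigma>\<bar> + real j) * ?y + ?y"
      using y h by (intro add_mono) (auto simp: mult_le_cancel_left1)
    finally have s: "cmod ?s + real j \<le> (K + real j) * ?y" by (simp add: K_def algebra_simps)
    have "cmod (blk j ?s) \<le> boost j * (1/4) ^ j * real (N j) powr (\<theta> - \<sigma>)
           * (8 * (boost j)\<^sup>2 * (cmod ?s + real j) * real (N j) powr (- v)) ^ j"
      using j by (intro block_le_cancellation) auto
    also have "\<dots> \<le> boost j * (1/4) ^ j * real (N j) powr (\<theta> - \<sigma>)
           * (8 * (boost j)\<^sup>2 * ((K + real j) * ?y) * real (N j) powr (- v)) ^ j"
      by (intro mult_left_mono mult_right_mono power_mono s) auto
    also have "\<dots> = (boost j * (8 * (boost j)\<^sup>2 * (K + real j)) ^ j) * (1/4) ^ j * real (N j) powr (\<theta> - \<sigma>)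
           * (?y * real (N j) powr (- v)) ^ j"
      by (simp add: power_mult_distrib)
    also have "\<dots> \<le> (C * real (N j) powr 1) * (1/4) ^ j * real (N j) powr (\<theta> - \<sigma>)
           * (?y * real (N j) powr (- v)) ^ j"
      by (intro mult_right_mono C) auto
    also have "?y * real (N j) powr (- v) = real (N j) powr (- (v / 2))"
      by (simp flip: powr_add)
    also have "(real (N j) powr (- (v / 2))) ^ j = real (N j) powr (- (v / 2) * real j)"
      by (subst powr_power) (auto simp: mult.commute)
    also have "(C * real (N j) powr 1) * (1/4) ^ j * real (N j) powr (\<theta> - \<sigma>) * real (N j) powr (- (v / 2) * real j)
       = C * (1/4) ^ j * real (N j) powr (1 + (\<theta> - \<sigma>) + - (v / 2) * real j)"
      by (simp only: powr_add mult_ac)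
    also have "\<dots> \<le> C * (1/4) ^ j * 1"
    proof (intro mult_left_mono)
      have "1 + (\<theta> - \<sigma>) + - (v / 2) * real j \<le> 0"
        using j(2) v_pos by (simp add: field_simps)
      then have "real (N j) powr (1 + (\<theta> - \<sigma>) + - (v / 2) * real j) \<le> real (N j) powr 0"
        using N_ge_2[of j] by (intro powr_mono) auto
      then show "real (N j) powr (1 + (\<theta> - \<sigma>) + - (v / 2) * real j) \<le> 1" by simp
    qed (use C(1) in auto)
    finally show ?thesis by simp
  qed
  define c1 where "c1 = 2 powr (- \<bar>\<sigma>\<bar>) / 4"
  define c2 where "c2 = 2 powr \<bar>\<sigma>\<bar>"
  have c: "c1 > 0" "c2 > 0" by (auto simp: c1_def c2_def)
  have "\<forall>\<^sub>F i in sequentially. c1 * (boost i / 4 ^ i) - c2 * (boost i / 8 ^ i) - 2 * C \<ge> 1"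
    unfolding boost_def using c C(1) by real_asymp
  moreover have "\<forall>\<^sub>F i in sequentially. real i \<ge> - \<sigma>" by real_asymp
  moreover have "\<forall>\<^sub>F i in sequentially. real i \<ge> 2 * (1 + \<theta> - \<sigma>) / v"
    using filterlim_real_sequentially by (simp add: filterlim_at_top)
  ultimately show ?thesis
  proof eventually_elim
    case (elim i)
    let ?s = "Complex \<sigma> (height i)"
    let ?P = "real (N i) powr (\<theta> - \<sigma>)"
    have P: "?P \<ge> 1" using assms by (intro N_powr_ge_1) auto
    have main: "c1 * (boost i / 4 ^ i) * ?P \<le> cmod (blk i ?s)"
      using block_ge[of \<sigma> i] by (simp add: c1_def height_def)
    have "cmod (\<Sum>j<i. blk j ?s) \<le> (\<Sum>j<i. c2 * (boost j * ?P))"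
    proof (rule sum_norm_le)
      fix j assume j: "j \<in> {..<i}"
      have "cmod (blk j ?s) \<le> c2 * (boost j * (1/2) ^ j * real (N j) powr (\<theta> - \<sigma>))"
        unfolding c2_def by (rule block_le_trivial) simp
      also have "\<dots> \<le> c2 * (boost j * 1 * ?P)"
        using c j N_mono[of j i] assms by (intro mult_left_mono mult_mono powr_mono2 power_le_one) auto
      finally show "cmod (blk j ?s) \<le> c2 * (boost j * ?P)" by simp
    qed
    also have "\<dots> = c2 * (\<Sum>j<i. boost j) * ?P" by (simp add: sum_distrib_left sum_distrib_right mult_ac)
    also have "\<dots> \<le> c2 * (boost i / 8 ^ i) * ?P"
      using c by (intro mult_right_mono mult_left_mono sum_boost_le) auto
    finally have prev: "cmod (\<Sum>j<i. blk j ?s) \<le> c2 * (boost i / 8 ^ i) * ?P" .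
    have geo: "(\<lambda>n. C * (1/2) ^ n) sums (C * 2)"
      using sums_mult[OF geometric_sums[of "1/2::real"], of C] by simp
    have "cmod (\<Sum>n. blk (n + Suc i) ?s) \<le> (\<Sum>n. C * (1/2) ^ n)"
    proof (rule norm_suminf_le)
      fix n
      have "cmod (blk (n + Suc i) ?s) \<le> C * (1/4) ^ (n + Suc i)"
        using elim by (intro tail) auto
      also have "\<dots> \<le> C * (1/4) ^ n"
        using C(1) by (intro mult_left_mono power_decreasing) auto
      also have "\<dots> \<le> C * (1/2) ^ n"
        using C(1) by (intro mult_left_mono power_mono) auto
      finally show "cmod (blk (n + Suc i) ?s) \<le> C * (1/2) ^ n" .
    qed (use geo in \<open>auto dest: sums_summable\<close>)
    also have "\<dots> = C * 2" using geo by (rule sums_unique[symmetric])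
    also have "\<dots> \<le> 2 * C * ?P" using C(1) P by simp
    finally have tl: "cmod (\<Sum>n. blk (n + Suc i) ?s) \<le> 2 * C * ?P" .
    have "F ?s = (\<Sum>n. blk (n + Suc i) ?s) + ((\<Sum>j<i. blk j ?s) + blk i ?s)"
      unfolding F_def by (subst suminf_split_initial_segment[OF F_summable, of _ "Suc i"]) simp
    then have eq: "blk i ?s = F ?s - (\<Sum>n. blk (n + Suc i) ?s) - (\<Sum>j<i. blk j ?s)" by simp
    have "cmod (blk i ?s) \<le> cmod (F ?s) + cmod (\<Sum>n. blk (n + Suc i) ?s) + cmod (\<Sum>j<i. blk j ?s)"
      unfolding eq
      using norm_triangle_ineq4[of "F ?s - (\<Sum>n. blk (n + Suc i) ?s)" "\<Sum>j<i. blk j ?s"]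
        norm_triangle_ineq4[of "F ?s" "\<Sum>n. blk (n + Suc i) ?s"] by linarith
    then have "(c1 * (boost i / 4 ^ i) - c2 * (boost i / 8 ^ i) - 2 * C) * ?P \<le> cmod (F ?s)"
      using main prev tl by (simp add: left_diff_distrib)
    moreover have "1 * ?P \<le> (c1 * (boost i / 4 ^ i) - c2 * (boost i / 8 ^ i) - 2 * C) * ?P"
      using elim(1) by (intro mult_right_mono) auto
    ultimately show ?case by linarith
  qed
qed

lemma lindelof_order_le:
  assumes "\<sigma> \<le> \<theta>"
  shows "lindelof_order F \<sigma> \<le> ereal ((\<theta> - \<sigma>) / v)"
proof (rule ereal_le_epsilon2)
  fix \<epsilon> :: real assume eps: "\<epsilon> > 0"
  define A where "A = (\<theta> - \<sigma>) / v"
  have A: "A \<ge> 0" using assms v_pos by (simp add: A_def)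
  obtain C where C: "C > 0" "\<And>s. \<sigma> \<le> Re s \<Longrightarrow> cmod (F s) \<le> C * (1 + \<bar>Im s\<bar>) powr (A + \<epsilon> / 2)"
    using F_bound[OF assms, of "\<epsilon> / 2"] eps unfolding A_def by auto
  have "\<forall>\<^sub>F x in at_top. ln C + (A + \<epsilon> / 2) * ln (1 + x) \<le> (A + \<epsilon>) * ln x"
    using eps A C(1) by real_asymp
  then have "\<forall>\<^sub>F x::real in at_top. ln C + (A + \<epsilon> / 2) * ln (1 + x) \<le> (A + \<epsilon>) * ln x \<and> x > 1"
    using eventually_gt_at_top[of "1::real"] by eventually_elim simp
  moreover have "filterlim (\<lambda>t::real. \<bar>t\<bar>) at_top at_infinity"
    using filterlim_norm_at_top[where 'a = real] by (simp add: real_norm_def[abs_def])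
  ultimately have "\<forall>\<^sub>F t::real in at_infinity.
      ln C + (A + \<epsilon> / 2) * ln (1 + \<bar>t\<bar>) \<le> (A + \<epsilon>) * ln \<bar>t\<bar> \<and> \<bar>t\<bar> > 1"
    by (rule eventually_compose_filterlim)
  then have "\<forall>\<^sub>F t in at_infinity. log_norm (F (Complex \<sigma> t)) / ereal (ln \<bar>t\<bar>) \<le> ereal (A + \<epsilon>)"
  proof eventually_elim
    case (elim t)
    have t: "ln \<bar>t\<bar> > 0" using elim ln_gt_zero by blast
    show ?case
    proof (cases "F (Complex \<sigma> t) = 0")
      case True
      then show ?thesis using t by (simp add: log_norm_def)
    next
      case False
      have "ln (cmod (F (Complex \<sigma> t))) \<le> ln (C * (1 + \<bar>t\<bar>) powr (A + \<epsilon> / 2))"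
        using False C(2)[of "Complex \<sigma> t"] by (intro ln_mono) auto
      also have "\<dots> = ln C + (A + \<epsilon> / 2) * ln (1 + \<bar>t\<bar>)"
        using C(1) by (subst ln_mult) (auto simp: ln_powr)
      also have "\<dots> \<le> (A + \<epsilon>) * ln \<bar>t\<bar>" using elim by simp
      finally show ?thesis using False t by (simp add: log_norm_def pos_divide_le_eq)
    qed
  qed
  then show "lindelof_order F \<sigma> \<le> ereal ((\<theta> - \<sigma>) / v) + ereal \<epsilon>"
    unfolding lindelof_order_def by (simp add: A_def Limsup_bounded)
qed

text \<open>Along the resonance heights the estimate is exact: \<open>\<bar>F\<bar> \<ge> N powr (\<theta> - \<sigma>)\<close> and
\<open>height \<le> N powr v\<close> give the exponent without any loss.\<close>
lemma lindelof_order_ge: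
  assumes "\<sigma> \<le> \<theta>"
  shows "ereal ((\<theta> - \<sigma>) / v) \<le> lindelof_order F \<sigma>"
  unfolding lindelof_order_def Limsup_def
proof (rule INF_greatest)
  fix P assume "P \<in> {P. eventually P (at_infinity :: real filter)}"
  then have "\<forall>\<^sub>F i in sequentially. P (height i)"
    using filterlim_at_top_imp_at_infinity[OF height_at_top] by (auto simp: filterlim_iff)
  with F_large[OF assms] have "\<forall>\<^sub>F i in sequentially.
      P (height i) \<and> real (N i) powr (\<theta> - \<sigma>) \<le> cmod (F (Complex \<sigma> (height i)))"
    by eventually_elim simp
  then obtain i where i: "P (height i)" "real (N i) powr (\<theta> - \<sigma>) \<le> cmod (F (Complex \<sigma> (height i)))"
    by (auto simp: eventually_at_top_linorder)
  let ?F = "F (Complex \<sigma> (height i))"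
  have "1 * 3 \<le> real (Suc i) * pi" using pi_gt3 by (intro mult_mono) auto
  then have h: "height i > 1" using height_ge[of i] by linarith
  have N_pow: "0 < real (N i) powr (\<theta> - \<sigma>)" by simp
  then have F: "?F \<noteq> 0" using i(2) by auto
  have "(\<theta> - \<sigma>) / v * ln (height i) \<le> (\<theta> - \<sigma>) / v * ln (real (N i) powr v)"
    using assms v_pos h height_le[of i] by (intro mult_left_mono ln_mono) auto
  also have "\<dots> = ln (real (N i) powr (\<theta> - \<sigma>))"
    using v_pos by (simp add: ln_powr)
  also have "\<dots> \<le> ln (cmod ?F)" using i(2) N_pow by (intro ln_mono) auto
  finally have "ereal ((\<theta> - \<sigma>) / v) \<le> log_norm ?F / ereal (ln \<bar>height i\<bar>)"
    using h F by (simp add: log_norm_def pos_le_divide_eq)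
  then show "ereal ((\<theta> - \<sigma>) / v) \<le> (SUP t\<in>Collect P. log_norm (F (Complex \<sigma> t)) / ereal (ln \<bar>t\<bar>))"
    using i(1) by (intro SUP_upper2[of "height i"]) auto
qed

lemma lindelof_order_F:
  assumes "\<sigma> \<le> \<theta>"
  shows "lindelof_order F \<sigma> = ereal (\<beta> - (1 + 2 * \<beta>) * \<sigma>)"
proof -
  have "(\<theta> - \<sigma>) / v = \<beta> - (1 + 2 * \<beta>) * \<sigma>"
    using beta_pos by (simp add: \<theta>_def v_def field_simps)
  then show ?thesis
    using lindelof_order_le[OF assms] lindelof_order_ge[OF assms] by simp
qed

end

theorem theorem4:
  fixes \<beta> :: real
  assumes "\<beta> > 0"
  shows "\<exists>(a :: nat \<Rightarrow> complex) (f :: complex \<Rightarrow> complex).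
           a \<in> hardy_H2 \<and>
           entire_extension a f \<and>
           (\<forall>\<kappa> :: real. finite_order_on_half_plane f \<kappa>) \<and>
           conv_abscissa a = ereal (\<beta> / (1 + 2 * \<beta>)) \<and>
           abs_conv_abscissa a = ereal (\<beta> / (1 + 2 * \<beta>)) \<and>
           (\<forall>\<sigma> :: real. \<sigma> \<le> \<beta> / (1 + 2 * \<beta>) \<longrightarrow>
              lindelof_order f \<sigma> = ereal (\<beta> - (1 + 2 * \<beta>) * \<sigma>))"
proof -
  interpret lindelof_example \<beta> by unfold_locales (rule assms)
  show ?thesis
    unfolding \<theta>_def[symmetric]
    by (intro exI[of _ coeff], intro exI[of _ F] conjI allI impI coeff_in_H2 F_entire_extension
        F_finite_order conv_abscissa_coeff abs_conv_abscissa_coeff lindelof_order_F)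
qed

end
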